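(* Let $\ell\ge3$ be odd, let $\Phi$ be a root system of type $C_\ell$, and let $\omega\in W_{A_\circ}=\{1,\omega_\ell\}$. Then for every $q\in\mathbb{Z}_{>0}$, $$\chi_{\Phi,q}(\omega) = \begin{cases} (q-1)(q-3)\cdots(q-(2\ell-1)) & \text{if }\omega=1\text{ and }q\notin2\mathbb{Z},\\ (q-2)(q-4)\cdots(q-2(\ell-1))\,(q-\ell) & \text{if }\omega=1\text{ and }q\in2\mathbb{Z},\\ 0 & \text{if }\omega=\omega_\ell\text{ and }\gcd\{4,q\}=1,\\ \prod_{i=1}^{(\ell-1)/2}(q-(4i-2)) = (q-2)(q-6)\cdots(q-2(\ell-2)) & \text{if }\omega=\omega_\ell\text{ and }\gcd\{4,q\}=2,\\ \prod_{i=1}^{(\ell-1)/2}(q-4i) = (q-4)(q-8)\cdots(q-2(\ell-1)) & \text{if }\omega=\omega_\ell\text{ and }\gcd\{4,q\}=4.\end{cases}$$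
   Context: Let $\Phi = \{\pm e_i\pm e_k\ (i<k),\ \pm 2e_k\}\subset E=\mathbb{R}^\ell$, with simple roots $\alpha_i=e_i-e_{i+1}$ ($1\le i\le\ell-1$), $\alpha_\ell=2e_\ell$, Weyl group $W$ and the standard inner product $(\cdot,\cdot)$. The coweight lattice is $Z := \{x\in E : (\alpha,x)\in\mathbb{Z}\ \forall\alpha\in\Phi\}$. For $q\in\mathbb{Z}_{>0}$, $M(\Phi;q) := \{x+qZ\in Z/qZ : (\beta,x)\not\equiv0\pmod q\ \forall\beta\in\Phi\}$; $W$ acts on it via $w(x+qZ)=w(x)+qZ$, and $\chi_{\Phi,q}(w) := \#\{t\in M(\Phi;q) : w(t)=t\}$. Let $\tilde\alpha=\sum_{i=1}^\ell n_i\alpha_i$ be the highest root, $n_0:=1$, $J:=\{i\in\{0,\dots,\ell\}: n_i=1\}$ (here $J=\{0,\ell\}$). Let $w_0$ be the longest element of $W$; for $j\in J\setminus\{0\}$ let $w_j$ be the longest element of the subgroup generated by the simple reflections $s_{\alpha_i}$, $i\ne j$; put $\omega_j := w_jw_0$ and $\omega_0:=1$. Let $A_\circ=\{x\in E : (\alpha_i,x)>0\ \forall i,\ (\tilde\alpha,x)<1\}$; $W_{A_\circ}$ is the subgroup of $w\in W$ mapping the image of $A_\circ$ in $E/Z$ to itself, and $W_{A_\circ}=\{\omega_j : j\in J\}$. *)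

theory Defs
  imports "HOL-Analysis.Analysis" "HOL-Algebra.Bij" "HOL-Algebra.Generated_Groups"
begin

text \<open>
  Here \<open>e 1, \<dots>, e l\<close> stand for the standard orthonormal basis. In general, \<open>\<Phi>\<close> is a root system
  with simple roots \<open>\<alpha> 1, \<dots>, \<alpha> l\<close>.
\<close>

definition roots_C :: "nat \<Rightarrow> (nat \<Rightarrow> 'a::real_inner) \<Rightarrow> 'a set" where
  "roots_C l e =
     (\<Union>k\<in>{1..l}. \<Union>i\<in>{1..<k}. {e i + e k, e i - e k, - e i + e k, - e i - e k}) \<union>
     (\<Union>k\<in>{1..l}. {2 *\<^sub>R e k, - (2 *\<^sub>R e k)})"

definition simple_root_C :: "nat \<Rightarrow> (nat \<Rightarrow> 'a::real_inner) \<Rightarrow> nat \<Rightarrow> 'a" where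
  "simple_root_C l e i = (if i = l then 2 *\<^sub>R e l else e i - e (Suc i))"

definition reflection :: "'a::real_inner \<Rightarrow> 'a \<Rightarrow> 'a" where
  "reflection a x = x - (2 * (a \<bullet> x) / (a \<bullet> a)) *\<^sub>R a"

definition generated_group :: "('a \<Rightarrow> 'a) set \<Rightarrow> ('a \<Rightarrow> 'a) set" where
  "generated_group S = generate (BijGroup UNIV) S"

definition weyl_group :: "'a::real_inner set \<Rightarrow> ('a \<Rightarrow> 'a) set" where
  "weyl_group \<Phi> = generated_group (reflection ` \<Phi>)"

definition word_length :: "('a \<Rightarrow> 'a) set \<Rightarrow> ('a \<Rightarrow> 'a) \<Rightarrow> nat" where
  "word_length S w = (LEAST n. \<exists>ss. length ss = n \<and> set ss \<subseteq> S \<and> w = foldr (\<circ>) ss id)"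

definition simple_reflections :: "(nat \<Rightarrow> 'a::real_inner) \<Rightarrow> nat \<Rightarrow> ('a \<Rightarrow> 'a) set" where
  "simple_reflections \<alpha> l = (\<lambda>i. reflection (\<alpha> i)) ` {1..l}"

text \<open>
  Lengths are always taken with respect to all simple reflections. On a subgroup generated by some
  of them, this is the same as the length with respect to those generators.
\<close>

definition longest_element ::
  "(nat \<Rightarrow> 'a::real_inner) \<Rightarrow> nat \<Rightarrow> ('a \<Rightarrow> 'a) set \<Rightarrow> ('a \<Rightarrow> 'a)" where
  "longest_element \<alpha> l G =
     (THE w. is_arg_max (word_length (simple_reflections \<alpha> l)) (\<lambda>v. v \<in> G) w)"

definition omega :: "'a::real_inner set \<Rightarrow> (nat \<Rightarrow> 'a) \<Rightarrow> nat \<Rightarrow> nat \<Rightarrow> ('a \<Rightarrow> 'a)" where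
  "omega \<Phi> \<alpha> l j =
     (if j = 0 then id
      else longest_element \<alpha> l (generated_group ((\<lambda>i. reflection (\<alpha> i)) ` ({1..l} - {j})))
           \<circ> longest_element \<alpha> l (weyl_group \<Phi>))"

definition highest_root :: "'a::real_inner set \<Rightarrow> (nat \<Rightarrow> 'a) \<Rightarrow> nat \<Rightarrow> 'a" where
  "highest_root \<Phi> \<alpha> l =
     (THE \<gamma>. \<gamma> \<in> \<Phi> \<and> (\<forall>\<beta>\<in>\<Phi>. \<exists>c::nat \<Rightarrow> nat. \<gamma> - \<beta> = (\<Sum>i=1..l. real (c i) *\<^sub>R \<alpha> i)))"

definition fundamental_alcove :: "'a::real_inner set \<Rightarrow> (nat \<Rightarrow> 'a) \<Rightarrow> nat \<Rightarrow> 'a set" where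
  "fundamental_alcove \<Phi> \<alpha> l =
     {x. (\<forall>i\<in>{1..l}. \<alpha> i \<bullet> x > 0) \<and> highest_root \<Phi> \<alpha> l \<bullet> x < 1}"

definition coweight_lattice :: "'a::real_inner set \<Rightarrow> 'a set" where
  "coweight_lattice \<Phi> = {x. \<forall>\<beta>\<in>\<Phi>. \<beta> \<bullet> x \<in> \<int>}"

text \<open>
  The coset \<open>x + qZ\<close>. Elements of \<open>E/Z\<close> are the cosets with \<open>q = 1\<close>. As Weyl group elements are linear
  and preserve \<open>Z\<close>, the action \<open>w(x + qZ) = w(x) + qZ\<close> is the image of the coset under \<open>w\<close>.
\<close>

definition lattice_coset :: "'a::real_inner set \<Rightarrow> nat \<Rightarrow> 'a \<Rightarrow> 'a set" where
  "lattice_coset \<Phi> q x = {x + real q *\<^sub>R z | z. z \<in> coweight_lattice \<Phi>}"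

definition alcove_stabilizer ::
  "'a::real_inner set \<Rightarrow> (nat \<Rightarrow> 'a) \<Rightarrow> nat \<Rightarrow> ('a \<Rightarrow> 'a) set" where
  "alcove_stabilizer \<Phi> \<alpha> l =
     {w \<in> weyl_group \<Phi>.
        (\<lambda>t. w ` t) ` lattice_coset \<Phi> 1 ` fundamental_alcove \<Phi> \<alpha> l
          = lattice_coset \<Phi> 1 ` fundamental_alcove \<Phi> \<alpha> l}"

definition toric_complement :: "'a::real_inner set \<Rightarrow> nat \<Rightarrow> 'a set set" where
  "toric_complement \<Phi> q =
     {lattice_coset \<Phi> q x | x. x \<in> coweight_lattice \<Phi> \<and>
        (\<forall>\<beta>\<in>\<Phi>. \<not> (\<exists>k::int. \<beta> \<bullet> x = real q * of_int k))}"

definition fixed_count :: "'a::real_inner set \<Rightarrow> nat \<Rightarrow> ('a \<Rightarrow> 'a) \<Rightarrow> nat" where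
  "fixed_count \<Phi> q w = card {t \<in> toric_complement \<Phi> q. w ` t = t}"

end

theory Submission
  imports Defs
begin

text \<open>
  In the coordinates \<open>x \<bullet> e i\<close> the Weyl group of type \<open>C\<close> is the hyperoctahedral group of all
  signed permutations, and everything becomes a count of residues.

  \<^bold>\<open>The element \<open>\<omega>\<close>.\<close> Let \<open>\<rho>\<close> be the half sum of the positive roots. The number of
  inversions of \<open>w\<close>, the positive roots \<open>\<beta>\<close> with \<open>w \<beta> \<bullet> \<rho> < 0\<close>, grows by at most one when \<open>w\<close> is
  multiplied by a simple reflection, and drops for a suitable one unless \<open>w\<close> is the identity.
  Hence the word length is the number of inversions (\<open>word_length_eq_inversions\<close>), the simple
  reflections generate all signed permutations (\<open>weyl_group_eq\<close>), and the longest element of a group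
  of signed permutations is the one that inverts as much as possible: \<open>- id\<close> for the whole group, and
  the reversal \<open>e i \<mapsto> e (l + 1 - i)\<close> for the parabolic subgroup of permutations. So \<open>\<omega>\<close> maps the
  coordinates \<open>(x\<^sub>1, \<dots>, x\<^sub>l)\<close> to \<open>(- x\<^sub>l, \<dots>, - x\<^sub>1)\<close> (\<open>omega_eq\<close>).

  \<^bold>\<open>The stabilizer.\<close> The coweight lattice consists of the vectors whose coordinates are all integers or
  all half-integers, and the alcove is \<open>1/2 > x\<^sub>1 > \<dots> > x\<^sub>l > 0\<close>. If \<open>w\<close> maps a point of the alcove
  to a lattice translate \<open>y + z\<close> of another point, then all coordinates of \<open>y + z\<close> lie in
  \<open>(-1/2, 1/2)\<close>, so that \<open>z\<close> is either \<open>0\<close> or \<open>(-1/2, \<dots>, -1/2)\<close>. In these two cases \<open>w\<close> and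
  \<open>\<omega> \<circ> w\<close>, respectively, map a dominant point to a dominant point, and so they are the identity
  (\<open>alcove_stabilizer_eq\<close>).

  \<^bold>\<open>Counting.\<close> Doubling the coordinates turns a point of the toric complement into \<open>l\<close> residues modulo
  \<open>2 q\<close> of equal parity, none divisible by \<open>q\<close> and no two equal up to sign, considered up to adding \<open>q\<close>
  to all of them. Exactly one member of such a pair has a chosen coordinate in \<open>[0, q)\<close>, so the points
  correspond to normal forms (\<open>bij_betw_normal_forms\<close>). Choosing residues one after the other, each
  choice excludes a class \<open>{u, - u}\<close> of two residues, which gives a product for each of the two
  parities; their sum is the value at the identity. A point is fixed by \<open>\<omega>\<close> if its coordinates satisfy
  \<open>u\<^sub>i + u\<^bsub>l + 1 - i\<^esub> \<equiv> q\<close> modulo \<open>2 q\<close> for all \<open>i\<close> (the other possibility, \<open>\<equiv> 0\<close>, is excluded by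
  the roots). In particular twice the middle coordinate is \<open>q\<close> modulo \<open>2 q\<close>: this is impossible for odd
  \<open>q\<close>, and for \<open>q = 2 h\<close> it makes the middle coordinate equal to \<open>h\<close>. The first \<open>(l - 1) div 2\<close>
  coordinates determine the point, and each of them excludes a class of the four residues that are
  \<open>\<plusminus> u\<close> modulo \<open>q\<close> (\<open>card_symmetric_forms\<close>). The residues available have the parity of \<open>h\<close> and are
  not divisible by \<open>h\<close>; there are \<open>q - 2\<close> or \<open>q - 4\<close> of them.
\<close>

section \<open>Words in involutions\<close>

text \<open>
  The products that occur in the definition of the word length, given a name of their own so that
  they are not rewritten to nested applications.
\<close>

definition word :: "('a \<Rightarrow> 'a) list \<Rightarrow> ('a \<Rightarrow> 'a)" where
  "word ss = foldr (\<circ>) ss id"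

lemma word_Nil: "word [] = id"
  and word_Cons: "word (s # ss) = s \<circ> word ss"
  by (simp_all add: word_def fun_eq_iff)

lemma word_append: "word (ss @ ts) = word ss \<circ> word ts"
  by (induction ss) (auto simp: comp_assoc word_Nil word_Cons)

lemma word_single [simp]: "word [s] = s"
  by (simp add: word_def)

lemma word_snoc: "word (ss @ [s]) = word ss \<circ> s"
  by (simp only: word_append word_single)

text \<open>
  Involutions are their own inverses, so closing under inverses adds nothing to the products of
  generators.
\<close>

lemma generated_group_involutions:
  fixes S :: "('a \<Rightarrow> 'a) set"
  assumes inv: "\<And>s. s \<in> S \<Longrightarrow> s \<circ> s = id"
  shows "generated_group S = {word ss | ss. set ss \<subseteq> S}"
proof -
  let ?B = "BijGroup (UNIV :: 'a set)"
  interpret group ?B by (rule group_BijGroup)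
  have carrier: "carrier ?B = {f. bij f}"
    by (auto simp: BijGroup_def Bij_def)
  have one_eq: "\<one>\<^bsub>?B\<^esub> = id"
    by (auto simp: BijGroup_def)
  have mult: "f \<otimes>\<^bsub>?B\<^esub> g = f \<circ> g" if "bij f" "bij g" for f g
    using that by (auto simp: BijGroup_def Bij_def compose_def)
  have S_bij: "bij s" if "s \<in> S" for s
    using inv[OF that] inv[OF that] by (rule o_bij)
  have S_inv: "inv\<^bsub>?B\<^esub> s = s" if "s \<in> S" for s
    using that S_bij[OF that] inv[OF that] by (intro inv_equality) (auto simp: carrier mult one_eq)
  have word_bij: "bij (word ss)" if "set ss \<subseteq> S" for ss
    using that
  proof (induction ss)
    case Nil
    show ?case unfolding word_Nil by (rule bij_id)
  next
    case (Cons s ss)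
    then have "bij (word ss)" "bij s" by (auto intro: S_bij)
    then show ?case unfolding word_Cons by (rule bij_comp)
  qed
  show ?thesis unfolding generated_group_def
  proof (intro equalityI subsetI)
    fix w assume "w \<in> generate ?B S"
    then show "w \<in> {word ss | ss. set ss \<subseteq> S}"
    proof induction
      case one
      then show ?case by (intro CollectI exI[of _ "[]"]) (auto simp only: one_eq word_Nil list.set)
    next
      case (incl h)
      then show ?case by (auto intro!: exI[of _ "[h]"])
    next
      case (inv h)
      then show ?case by (auto simp: S_inv intro!: exI[of _ "[h]"])
    next
      case (eng h1 h2)
      then obtain ss ts where "h1 = word ss" "set ss \<subseteq> S" "h2 = word ts" "set ts \<subseteq> S"
        by auto
      then show ?case
        by (auto simp: mult word_bij word_append intro!: exI[of _ "ss @ ts"])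
    qed
  next
    fix w assume "w \<in> {word ss | ss. set ss \<subseteq> S}"
    then obtain ss where ss: "w = word ss" "set ss \<subseteq> S" by auto
    have "word ss \<in> generate ?B S"
      using ss(2)
    proof (induction ss)
      case Nil
      show ?case using generate.one[of ?B S] unfolding one_eq word_Nil .
    next
      case (Cons s ss)
      then have "s \<otimes>\<^bsub>?B\<^esub> word ss \<in> generate ?B S"
        by (auto intro: generate.eng generate.incl)
      moreover have "s \<otimes>\<^bsub>?B\<^esub> word ss = s \<circ> word ss"
        using Cons.prems by (intro mult S_bij word_bij) simp_all
      ultimately show ?case by (simp only: word_Cons)
    qed
    then show "w \<in> generate ?B S" by (simp add: ss)
  qed
qed

text \<open>
  Multiply by a descent until the identity is reached; the reflections used, read backwards, form a
  word for \<open>w\<close>.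
\<close>

lemma ex_word_of_descents:
  fixes N :: "('a \<Rightarrow> 'a) \<Rightarrow> nat"
  assumes inv: "\<And>s. s \<in> S \<Longrightarrow> s \<circ> s = id"
    and descent: "\<And>w. w \<in> G \<Longrightarrow> w \<noteq> id \<Longrightarrow> \<exists>s\<in>S. w \<circ> s \<in> G \<and> N (w \<circ> s) < N w"
    and "w \<in> G"
  shows "\<exists>ss. set ss \<subseteq> S \<and> length ss \<le> N w \<and> w = word ss"
  using \<open>w \<in> G\<close>
proof (induction "N w" arbitrary: w rule: less_induct)
  case less
  show ?case
  proof (cases "w = id")
    case True
    then show ?thesis by (intro exI[of _ "[]"]) (auto simp only: word_Nil list.size list.set)
  next
    case False
    from descent[OF less.prems False]
    obtain s where s: "s \<in> S" "w \<circ> s \<in> G" "N (w \<circ> s) < N w"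
      by blast
    from less.hyps[OF s(3,2)]
    obtain ss where ss: "set ss \<subseteq> S" "length ss \<le> N (w \<circ> s)" "w \<circ> s = word ss"
      by blast
    have w: "w = word (ss @ [s])"
      unfolding word_snoc ss(3)[symmetric] comp_assoc inv[OF s(1)] comp_id by (rule refl)
    have "set (ss @ [s]) \<subseteq> S" "length (ss @ [s]) \<le> N w"
      using ss(1,2) s(1,3) by simp_all
    with w show ?thesis by blast
  qed
qed

text \<open>
  A function that grows by at most one with each generator is a lower bound for the word length.
  If in addition it can always be decreased, greedy descent yields a word attaining the bound.
\<close>

lemma word_length_eqI:
  fixes N :: "('a \<Rightarrow> 'a) \<Rightarrow> nat"
  assumes inv: "\<And>s. s \<in> S \<Longrightarrow> s \<circ> s = id"
    and "id \<in> G" "N id = 0"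
    and step: "\<And>w s. w \<in> G \<Longrightarrow> s \<in> S \<Longrightarrow> w \<circ> s \<in> G \<and> N (w \<circ> s) \<le> Suc (N w)"
    and descent: "\<And>w. w \<in> G \<Longrightarrow> w \<noteq> id \<Longrightarrow> \<exists>s\<in>S. N (w \<circ> s) < N w"
    and "w \<in> G"
  shows "word_length S w = N w"
proof -
  have bound: "word ss \<in> G \<and> N (word ss) \<le> length ss" if "set ss \<subseteq> S" for ss
    using that
  proof (induction ss rule: rev_induct)
    case Nil
    then show ?case using assms(2,3) by (simp only: word_Nil) simp
  next
    case (snoc s ss)
    then have IH: "word ss \<in> G" "N (word ss) \<le> length ss" "s \<in> S" by simp_all
    from step[OF IH(1,3)] IH(2) show ?case unfolding word_snoc length_append_singleton by linarith
  qed
  have "\<exists>s\<in>S. v \<circ> s \<in> G \<and> N (v \<circ> s) < N v" if "v \<in> G" "v \<noteq> id" for v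
    using descent[OF that] step[OF that(1)] by meson
  from ex_word_of_descents[OF inv this \<open>w \<in> G\<close>]
  obtain ss where ss: "set ss \<subseteq> S" "length ss \<le> N w" "w = word ss"
    by blast
  have "length ss = N w"
    using bound[OF ss(1)] ss(2) unfolding ss(3) by linarith
  show ?thesis unfolding word_length_def word_def[symmetric]
  proof (rule Least_equality)
    show "\<exists>ss. length ss = N w \<and> set ss \<subseteq> S \<and> w = word ss"
      using ss(1,3) \<open>length ss = N w\<close> by blast
  next
    fix n assume "\<exists>ss. length ss = n \<and> set ss \<subseteq> S \<and> w = word ss"
    then show "N w \<le> n" using bound by blast
  qed
qed

text \<open>
  The longest element is a definite description, so besides maximality it requires that no other
  element has the same length.
\<close>

lemma longest_element_eqI:
  assumes "w \<in> G"
    and "\<And>v. v \<in> G \<Longrightarrow> word_length (simple_reflections \<alpha> l) v \<le> word_length (simple_reflections \<alpha> l) w"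
    and "\<And>v. v \<in> G \<Longrightarrow> word_length (simple_reflections \<alpha> l) v = word_length (simple_reflections \<alpha> l) w
          \<Longrightarrow> v = w"
  shows "longest_element \<alpha> l G = w"
  unfolding longest_element_def
proof (rule the_equality)
  show "is_arg_max (word_length (simple_reflections \<alpha> l)) (\<lambda>v. v \<in> G) w"
    using assms(1,2) by (auto simp: is_arg_max_def not_less)
next
  fix v assume "is_arg_max (word_length (simple_reflections \<alpha> l)) (\<lambda>v. v \<in> G) v"
  then show "v = w"
    using assms by (metis is_arg_max_def le_neq_implies_less)
qed

section \<open>The hyperoctahedral group and its inversions\<close>

lemma linear_reflection: "linear (reflection a)"
proof -
  define c where "c = 2 / (a \<bullet> a)"
  have "linear (\<lambda>x. (c * (a \<bullet> x)) *\<^sub>R a)"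
    by (rule linearI) (simp_all add: inner_add_right distrib_left scaleR_left_distrib)
  from linear_compose_sub[OF linear_ident this] show ?thesis
    by (simp add: reflection_def[abs_def] c_def)
qed

lemma inner_reflection_reflection: "reflection a x \<bullet> reflection a y = x \<bullet> y"
proof (cases "a = 0")
  case False
  define c p r where "c = 2 / (a \<bullet> a)" "p = a \<bullet> x" "r = a \<bullet> y"
  have refl: "reflection a z = z - (c * (a \<bullet> z)) *\<^sub>R a" for z
    by (simp add: reflection_def c_p_r_def)
  have "reflection a x \<bullet> reflection a y
      = x \<bullet> y - c * p * r - (c * r) * (p - (c * p) * (a \<bullet> a))"
    unfolding refl c_p_r_def(2,3)
    by (simp only: inner_diff_left inner_diff_right inner_scaleR_left inner_scaleR_right inner_commute[of x a])
  also have "\<dots> = x \<bullet> y - (2 - c * (a \<bullet> a)) * (c * p * r)"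
    by (simp only: algebra_simps)
  also have "c * (a \<bullet> a) = 2"
    using False by (simp add: c_p_r_def)
  finally show ?thesis by simp
qed (simp add: reflection_def)

lemma orthogonal_transformation_reflection: "orthogonal_transformation (reflection a)"
  unfolding orthogonal_transformation_def
  using linear_reflection inner_reflection_reflection by blast

lemma reflection_self:
  assumes "a \<noteq> 0"
  shows "reflection a a = - a"
proof -
  have "2 * (a \<bullet> a) / (a \<bullet> a) = 2" using assms by simp
  then show ?thesis unfolding reflection_def by (simp only: scaleR_2) simp
qed

lemma reflection_reflection [simp]: "reflection a (reflection a x) = x"
proof (cases "a = 0")
  case False
  have "- a \<bullet> reflection a x = a \<bullet> x"
    using inner_reflection_reflection[of a a x] by (simp only: reflection_self[OF False])
  then have "a \<bullet> reflection a x = - (a \<bullet> x)"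
    by (simp only: inner_minus_left minus_equation_iff)
  then have "reflection a (reflection a x) = reflection a x + (2 * (a \<bullet> x) / (a \<bullet> a)) *\<^sub>R a"
    by (subst reflection_def) simp
  then show ?thesis by (simp only: reflection_def diff_add_cancel)
qed (simp add: reflection_def)

lemma reflection_involution: "reflection a \<circ> reflection a = id"
  by (simp add: fun_eq_iff)

text \<open>
  The standard basis of the statement, for an arbitrary Euclidean space.
\<close>

locale orthonormal_frame =
  fixes l :: nat and e :: "nat \<Rightarrow> 'a::euclidean_space"
  assumes bij_e: "bij_betw e {1..l} Basis"
begin

abbreviation "Phi \<equiv> roots_C l e"
abbreviation "alpha \<equiv> simple_root_C l e"

definition signed_basis :: "'a set" where
  "signed_basis = e ` {1..l} \<union> uminus ` e ` {1..l}"

text \<open>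
  The signed permutations of the frame, described without indices. This description is closed under
  composition for trivial reasons, and it is the form in which elements of the Weyl group are used
  below.
\<close>

definition hyperoctahedral :: "('a \<Rightarrow> 'a) set" where
  "hyperoctahedral = {w. orthogonal_transformation w \<and> w ` signed_basis \<subseteq> signed_basis}"

text \<open>
  Half the sum of the positive roots of type \<open>C\<close>. Its coordinates \<open>l, l - 1, \<dots>, 1\<close> are distinct and
  positive, so the sign of \<open>\<beta> \<bullet> rho\<close> separates the positive roots from the negative ones, and the value
  \<open>d \<bullet> rho\<close> determines a vector \<open>d\<close> of the signed basis.
\<close>

definition rho :: 'a where
  "rho = (\<Sum>i=1..l. (real l + 1 - real i) *\<^sub>R e i)"

definition positive_roots :: "'a set" where
  "positive_roots = {\<beta> \<in> Phi. \<beta> \<bullet> rho > 0}"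

definition inversions :: "('a \<Rightarrow> 'a) \<Rightarrow> 'a set" where
  "inversions w = {\<beta> \<in> positive_roots. w \<beta> \<bullet> rho < 0}"

lemma Basis_eq: "Basis = e ` {1..l}"
  using bij_e by (simp add: bij_betw_def)

lemma l_pos: "l > 0"
  using Basis_eq nonempty_Basis by (cases l) auto

lemma e_inj: "i \<in> {1..l} \<Longrightarrow> j \<in> {1..l} \<Longrightarrow> e i = e j \<longleftrightarrow> i = j"
  using bij_e unfolding bij_betw_def by (meson inj_on_eq_iff)

lemma e_inner:
  assumes "i \<in> {1..l}" "j \<in> {1..l}"
  shows "e i \<bullet> e j = (if i = j then 1 else 0)"
proof -
  have "e i \<in> Basis" "e j \<in> Basis" using assms by (simp_all add: Basis_eq)
  then show ?thesis using e_inj[OF assms] by (simp only: inner_Basis)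
qed

lemma inner_sum_e: "k \<in> {1..l} \<Longrightarrow> (\<Sum>i=1..l. f i *\<^sub>R e i) \<bullet> e k = f k"
proof -
  assume k: "k \<in> {1..l}"
  have "(\<Sum>i=1..l. f i *\<^sub>R e i) \<bullet> e k = (\<Sum>i=1..l. f i * (e i \<bullet> e k))"
    by (simp add: inner_sum_left)
  also have "\<dots> = (\<Sum>i=1..l. if i = k then f i else 0)"
    using k by (intro sum.cong) (auto simp: e_inner)
  also have "\<dots> = f k" using k by simp
  finally show ?thesis .
qed

lemma e_inner_rho: "k \<in> {1..l} \<Longrightarrow> e k \<bullet> rho = real l + 1 - real k"
  unfolding rho_def using inner_sum_e[of k "\<lambda>i. real l + 1 - real i"] by (simp add: inner_commute)

lemma frame_eqI: "(\<And>i. i \<in> {1..l} \<Longrightarrow> x \<bullet> e i = y \<bullet> e i) \<Longrightarrow> x = y"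
  by (rule euclidean_eqI) (auto simp: Basis_eq)

lemma frame_linear_eqI:
  assumes "linear f" "linear g" "\<And>i. i \<in> {1..l} \<Longrightarrow> f (e i) = g (e i)"
  shows "f = g"
proof
  fix x show "f x = g x"
    by (rule linear_eq_on[OF assms(1,2), of x Basis]) (auto simp: span_Basis, auto simp: Basis_eq assms(3))
qed

lemma uminus_signed_basis: "d \<in> signed_basis \<Longrightarrow> - d \<in> signed_basis"
  by (auto simp: signed_basis_def)

lemma e_signed_basis: "i \<in> {1..l} \<Longrightarrow> e i \<in> signed_basis"
  by (auto simp: signed_basis_def)

lemma signed_basisE:
  assumes "d \<in> signed_basis"
  obtains i where "i \<in> {1..l}" "d = e i" | i where "i \<in> {1..l}" "d = - e i"
  using assms by (auto simp: signed_basis_def)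

lemma signed_basis_self_inner: "d \<in> signed_basis \<Longrightarrow> d \<bullet> d = 1"
  by (erule signed_basisE) (auto simp: e_inner)

lemma signed_basis_cases: 
  assumes "a \<in> signed_basis" "b \<in> signed_basis"
  shows "a = b \<or> a = - b \<or> a \<bullet> b = 0"
  using assms by (elim signed_basisE) (auto simp: e_inner split: if_splits)

lemma signed_basis_rho:
  assumes "d \<in> signed_basis"
  shows "\<bar>d \<bullet> rho\<bar> \<ge> 1" "\<bar>d \<bullet> rho\<bar> \<le> real l" "d \<bullet> rho \<in> \<int>"
  using assms by (elim signed_basisE; auto simp: e_inner_rho)+

lemma signed_basis_eqI:
  assumes "a \<in> signed_basis" "b \<in> signed_basis" "a \<bullet> rho = b \<bullet> rho"
  shows "a = b"
  using assms by (elim signed_basisE) (auto simp: e_inner_rho)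

lemma root_iff:
  "x \<in> Phi \<longleftrightarrow>
    (\<exists>k\<in>{1..l}. \<exists>i\<in>{1..<k}. x = e i + e k \<or> x = e i - e k \<or> x = - e i + e k \<or> x = - e i - e k) \<or>
    (\<exists>k\<in>{1..l}. x = 2 *\<^sub>R e k \<or> x = - (2 *\<^sub>R e k))"
  unfolding roots_C_def by simp

lemma signed_basis_add_nonzero:
  assumes "a \<in> signed_basis" "b \<in> signed_basis" "a = b \<or> a \<bullet> b = 0"
  shows "a + b \<noteq> 0"
proof
  assume "a + b = 0"
  then have "a \<bullet> (a + b) = a \<bullet> 0" by (rule arg_cong)
  then have eq: "a \<bullet> a + a \<bullet> b = 0" by (simp only: inner_add_right inner_zero_right)
  from assms(3) show False
  proof
    assume "a = b"
    then have "b \<bullet> b + b \<bullet> b = 0" using eq by (simp only:)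
    then show False using signed_basis_self_inner[OF assms(2)] by linarith
  next
    assume "a \<bullet> b = 0"
    then show False using eq signed_basis_self_inner[OF assms(1)] by linarith
  qed
qed

text \<open>
  A root is a sum of two vectors of the signed basis. This symmetric description shows at once that
  signed permutations preserve the roots.
\<close>

lemma roots_eq: "Phi = {a + b | a b. a \<in> signed_basis \<and> b \<in> signed_basis \<and> a + b \<noteq> 0}" (is "_ = ?R")
proof (intro equalityI subsetI)
  fix x assume x: "x \<in> Phi"
  have R: "a + b \<in> ?R" if "a \<in> signed_basis" "b \<in> signed_basis" "a = b \<or> a \<bullet> b = 0" for a b
    using signed_basis_add_nonzero[OF that] that by blast
  from x[unfolded root_iff] show "x \<in> ?R"
  proof (elim disjE bexE)
    fix i k assume ik: "k \<in> {1..l}" "i \<in> {1..<k}"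
    then have D: "e i \<in> signed_basis" "e k \<in> signed_basis" "- e i \<in> signed_basis" "- e k \<in> signed_basis"
      and orth: "e i \<bullet> e k = 0"
      by (auto simp: e_inner signed_basis_def)
    { assume "x = e i + e k" then show ?thesis using R[of "e i" "e k"] D orth by simp }
    { assume "x = e i - e k" then show ?thesis using R[of "e i" "- e k"] D orth by simp }
    { assume "x = - e i + e k" then show ?thesis using R[of "- e i" "e k"] D orth by simp }
    { assume "x = - e i - e k" then show ?thesis using R[of "- e i" "- e k"] D orth by simp }
  next
    fix k assume "k \<in> {1..l}"
    then have D: "e k \<in> signed_basis" "- e k \<in> signed_basis"
      by (auto simp: signed_basis_def)
    { assume "x = 2 *\<^sub>R e k" then show ?thesis using R[of "e k" "e k"] D by (simp add: scaleR_2) }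
    { assume "x = - (2 *\<^sub>R e k)" then show ?thesis using R[of "- e k" "- e k"] D by (simp add: scaleR_2) }
  qed
next
  fix x assume "x \<in> ?R"
  then obtain a b where ab: "a \<in> signed_basis" "b \<in> signed_basis" "a + b \<noteq> 0" "x = a + b" by auto
  obtain i where i: "i \<in> {1..l}" "a = e i \<or> a = - e i" using ab(1) by (auto elim: signed_basisE)
  obtain k where k: "k \<in> {1..l}" "b = e k \<or> b = - e k" using ab(2) by (auto elim: signed_basisE)
  consider "i < k" | "k < i" | "i = k" by linarith
  then show "x \<in> Phi"
  proof cases
    case 1
    then have "x \<in> {e i + e k, e i - e k, - e i + e k, - e i - e k}"
      using i k ab by auto
    then show ?thesis using 1 i(1) k(1) unfolding root_iff by (rule_tac disjI1, rule_tac bexI[of _ k], rule_tac bexI[of _ i]) simp_all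
  next
    case 2
    then have "x \<in> {e k + e i, e k - e i, - e k + e i, - e k - e i}"
      using i k ab by auto
    then show ?thesis using 2 i(1) k(1) unfolding root_iff by (rule_tac disjI1, rule_tac bexI[of _ i], rule_tac bexI[of _ k]) simp_all
  next
    case 3
    then have "x \<in> {2 *\<^sub>R e k, - (2 *\<^sub>R e k)}"
      using i k ab by (auto simp: scaleR_2)
    then show ?thesis using 3 i(1) k(1) unfolding root_iff by (rule_tac disjI2, rule_tac bexI[of _ k]) simp_all
  qed
qed

lemma rootI: "a \<in> signed_basis \<Longrightarrow> b \<in> signed_basis \<Longrightarrow> a + b \<noteq> 0 \<Longrightarrow> a + b \<in> Phi"
  by (auto simp: roots_eq)

lemma finite_roots: "finite Phi"
  by (auto simp: roots_C_def)

lemma uminus_root: "\<beta> \<in> Phi \<Longrightarrow> - \<beta> \<in> Phi"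
proof -
  assume "\<beta> \<in> Phi"
  then obtain a b where "a \<in> signed_basis" "b \<in> signed_basis" "a + b \<noteq> 0" "\<beta> = a + b"
    by (auto simp: roots_eq)
  then have "- a + - b \<in> Phi" by (intro rootI uminus_signed_basis) auto
  then show ?thesis by (simp add: \<open>\<beta> = a + b\<close>)
qed

lemma root_rho_nonzero: "\<beta> \<in> Phi \<Longrightarrow> \<beta> \<bullet> rho \<noteq> 0"
proof
  assume "\<beta> \<in> Phi" and 0: "\<beta> \<bullet> rho = 0"
  then obtain a b where "a \<in> signed_basis" "b \<in> signed_basis" "a + b \<noteq> 0" "\<beta> = a + b"
    by (auto simp: roots_eq)
  moreover from this 0 have "a \<bullet> rho = (- b) \<bullet> rho" by (simp add: inner_add_left)
  ultimately show False using signed_basis_eqI[of a "- b"] uminus_signed_basis by auto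
qed

lemma hyperoctahedralD:
  assumes "w \<in> hyperoctahedral"
  shows "linear w" "w x \<bullet> w y = x \<bullet> y" "d \<in> signed_basis \<Longrightarrow> w d \<in> signed_basis"
  using assms by (auto simp: hyperoctahedral_def orthogonal_transformation_def)

lemma id_hyperoctahedral: "id \<in> hyperoctahedral"
  by (auto simp: hyperoctahedral_def orthogonal_transformation_def linear_iff)

lemma comp_hyperoctahedral: 
  assumes "v \<in> hyperoctahedral" "w \<in> hyperoctahedral"
  shows "v \<circ> w \<in> hyperoctahedral"
proof -
  have "orthogonal_transformation (v \<circ> w)"
    using assms by (intro orthogonal_transformation_compose) (auto simp: hyperoctahedral_def)
  then show ?thesis using assms by (auto simp: hyperoctahedral_def image_subset_iff)
qed

lemma uminus_hyperoctahedral: "uminus \<in> hyperoctahedral"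
  by (auto simp: hyperoctahedral_def orthogonal_transformation_def linear_iff intro: uminus_signed_basis)

lemma hyperoctahedral_root: 
  assumes "w \<in> hyperoctahedral" "\<beta> \<in> Phi"
  shows "w \<beta> \<in> Phi"
proof -
  obtain a b where ab: "a \<in> signed_basis" "b \<in> signed_basis" "a + b \<noteq> 0" "\<beta> = a + b"
    using assms(2) by (auto simp: roots_eq)
  have "w \<beta> \<bullet> w \<beta> \<noteq> 0" using ab by (simp add: hyperoctahedralD(2)[OF assms(1)])
  then have "w a + w b \<noteq> 0"
    using ab by (auto simp: linear_add[OF hyperoctahedralD(1)[OF assms(1)]])
  then show ?thesis
    using ab rootI[of "w a" "w b"] hyperoctahedralD(3)[OF assms(1)]
    by (simp add: linear_add[OF hyperoctahedralD(1)[OF assms(1)]])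
qed

text \<open>
  The reflection in \<open>a + b\<close> interchanges \<open>a\<close> with \<open>- b\<close> and fixes the basis vectors orthogonal to both;
  for \<open>a = b\<close> it is the sign change of \<open>a\<close>.
\<close>

lemma reflection_hyperoctahedral:
  assumes "\<beta> \<in> Phi"
  shows "reflection \<beta> \<in> hyperoctahedral"
proof -
  obtain a b where ab: "a \<in> signed_basis" "b \<in> signed_basis" "a + b \<noteq> 0" "\<beta> = a + b"
    using assms by (auto simp: roots_eq)
  have "reflection \<beta> d \<in> signed_basis" if d: "d \<in> signed_basis" for d
  proof (cases "a = b")
    case True
    have "\<beta> = 2 *\<^sub>R a" using ab(4) True by (simp add: scaleR_2)
    then have "reflection \<beta> d = d - (2 * (a \<bullet> d)) *\<^sub>R a"
      using signed_basis_self_inner[OF ab(1)] by (simp add: reflection_def)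
    moreover have "d = a \<or> d = - a \<or> a \<bullet> d = 0"
      using signed_basis_cases[OF d ab(1)] by (auto simp: inner_commute)
    ultimately show ?thesis
      using d signed_basis_self_inner[OF ab(1)] ab(1) uminus_signed_basis[OF ab(1)]
      by (auto simp: inner_minus_right scaleR_2)
  next
    case False
    with ab signed_basis_cases[OF ab(1,2)] have orth: "a \<bullet> b = 0" "b \<bullet> a = 0"
      by (auto simp: inner_commute)
    have "reflection \<beta> d = d - (a \<bullet> d + b \<bullet> d) *\<^sub>R (a + b)"
      using signed_basis_self_inner[OF ab(1)] signed_basis_self_inner[OF ab(2)] orth
      by (simp add: ab(4) reflection_def inner_add_left inner_add_right)
    moreover have "d = a \<or> d = - a \<or> a \<bullet> d = 0" "d = b \<or> d = - b \<or> b \<bullet> d = 0"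
      using signed_basis_cases[OF d ab(1)] signed_basis_cases[OF d ab(2)] by (auto simp: inner_commute)
    ultimately show ?thesis
      using d signed_basis_self_inner[OF ab(1)] signed_basis_self_inner[OF ab(2)] ab(1,2) orth
        uminus_signed_basis[OF ab(1)] uminus_signed_basis[OF ab(2)]
      by (auto simp: inner_minus_right)
  qed
  then show ?thesis
    using orthogonal_transformation_reflection[of \<beta>] by (auto simp: hyperoctahedral_def)
qed

lemma positive_root_cases:
  assumes "\<beta> \<in> positive_roots"
  obtains (diff) i k where "i \<in> {1..l}" "k \<in> {1..l}" "i < k" "\<beta> = e i - e k"
    | (sum) i k where "i \<in> {1..l}" "k \<in> {1..l}" "i < k" "\<beta> = e i + e k"
    | (double) k where "k \<in> {1..l}" "\<beta> = 2 *\<^sub>R e k"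
proof -
  have "\<beta> \<in> Phi" and pos: "\<beta> \<bullet> rho > 0" using assms by (auto simp: positive_roots_def)
  from \<open>\<beta> \<in> Phi\<close>[unfolded root_iff] show ?thesis
  proof (elim disjE bexE)
    fix i k assume "k \<in> {1..l}" "i \<in> {1..<k}"
    then have ik: "i \<in> {1..l}" "k \<in> {1..l}" "i < k" by auto
    { assume "\<beta> = e i + e k" then show ?thesis by (rule sum[OF ik]) }
    { assume "\<beta> = e i - e k" then show ?thesis by (rule diff[OF ik]) }
    { assume "\<beta> = - e i + e k" then show ?thesis
        using pos ik by (simp add: inner_diff_left e_inner_rho) }
    { assume "\<beta> = - e i - e k" then show ?thesis
        using pos ik by (simp add: inner_diff_left e_inner_rho) }
  next
    fix k assume k: "k \<in> {1..l}"
    { assume "\<beta> = 2 *\<^sub>R e k" then show ?thesis by (rule double[OF k]) }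
    { assume "\<beta> = - (2 *\<^sub>R e k)" then show ?thesis
        using pos k by (simp add: e_inner_rho) }
  qed
qed

lemma alpha_last: "alpha l = 2 *\<^sub>R e l"
  and alpha_less: "i < l \<Longrightarrow> alpha i = e i - e (Suc i)"
  by (simp_all add: simple_root_C_def)

lemma alpha_positive: "i \<in> {1..l} \<Longrightarrow> alpha i \<in> positive_roots"
proof (cases "i = l")
  case True
  then show ?thesis using l_pos e_inner_rho[of l]
    unfolding positive_roots_def roots_C_def by (auto simp: alpha_last)
next
  case False
  assume "i \<in> {1..l}"
  with False have i: "i \<in> {1..l}" "Suc i \<in> {1..l}" "i < l" by auto
  then have "e i + - e (Suc i) \<in> Phi"
    by (intro rootI uminus_signed_basis e_signed_basis) (auto simp: e_inj)
  then show ?thesis using i by (simp add: positive_roots_def alpha_less e_inner_rho inner_diff_left)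
qed

lemma alpha_root: "i \<in> {1..l} \<Longrightarrow> alpha i \<in> Phi"
  using alpha_positive by (simp add: positive_roots_def)

lemma alpha_nonzero: "i \<in> {1..l} \<Longrightarrow> alpha i \<noteq> 0"
  using alpha_positive by (force simp: positive_roots_def)

text \<open>
  Positivity on the simple roots says that \<open>i \<mapsto> f (e i)\<close> decreases strictly and ends with a positive
  value. So positivity carries over to \<open>e i - e k\<close> for \<open>i < k\<close>, to \<open>e i + e k\<close> and to \<open>2 e k\<close>.
\<close>

lemma dominant_positive:
  fixes f :: "'a \<Rightarrow> real"
  assumes "linear f" and pos: "\<And>i. i \<in> {1..l} \<Longrightarrow> f (alpha i) > 0" and "\<beta> \<in> positive_roots"
  shows "f \<beta> > 0"
proof -
  interpret linear f by fact
  have step: "f (e (Suc i)) < f (e i)" if "i \<in> {1..<l}" for i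
    using pos[of i] that by (simp add: alpha_less diff)
  have decr: "i \<ge> 1 \<Longrightarrow> i < k \<Longrightarrow> k \<le> l \<Longrightarrow> f (e k) < f (e i)" for i k
  proof (induction k)
    case (Suc k)
    show ?case
    proof (cases "i = k")
      case True
      then show ?thesis using step[of k] Suc.prems by simp
    next
      case False
      then have "f (e k) < f (e i)" using Suc by simp
      then show ?thesis using step[of k] Suc.prems by simp
    qed
  qed simp
  have last: "f (e l) > 0"
    using pos[of l] l_pos by (simp add: alpha_last scale)
  have pos_e: "f (e k) > 0" if "k \<in> {1..l}" for k
    using decr[of k l] last that by (cases "k = l") auto
  from \<open>\<beta> \<in> positive_roots\<close> show ?thesis
  proof (cases rule: positive_root_cases)
    case (diff i k)
    then show ?thesis using decr[of i k] by (simp add: linear_diff[OF \<open>linear f\<close>])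
  next
    case (sum i k)
    then show ?thesis using pos_e[of i] pos_e[of k] by (simp add: add)
  next
    case (double k)
    then show ?thesis using pos_e[of k] by (simp add: scale)
  qed
qed

lemma dominant_positive_roots_iff:
  assumes dom: "\<And>i. i \<in> {1..l} \<Longrightarrow> alpha i \<bullet> x > 0" and "\<beta> \<in> Phi"
  shows "\<beta> \<bullet> x > 0 \<longleftrightarrow> \<beta> \<bullet> rho > 0"
proof -
  have pos: "\<gamma> \<bullet> x > 0" if "\<gamma> \<in> positive_roots" for \<gamma>
    using dominant_positive[of "\<lambda>\<gamma>. \<gamma> \<bullet> x", OF _ dom that]
    by (simp add: linear_iff inner_add_left)
  show ?thesis
    using pos[of \<beta>] pos[of "- \<beta>"] uminus_root[OF assms(2)] root_rho_nonzero[OF assms(2)] assms(2)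
    by (cases "\<beta> \<bullet> rho > 0") (auto simp: positive_roots_def not_less)
qed

lemma alpha_inner_rho: "i \<in> {1..l} \<Longrightarrow> 2 * (alpha i \<bullet> rho) = alpha i \<bullet> alpha i"
  by (cases "i = l")
    (auto simp: alpha_last alpha_less e_inner_rho e_inner inner_diff_left inner_diff_right)

text \<open>
  Since \<open>alpha i\<close> takes the value 1 on \<open>rho\<close> when it is normalized to a coroot, the reflection moves
  \<open>\<beta> \<bullet> rho\<close> to \<open>\<beta> \<bullet> rho - \<beta> \<bullet> alpha i\<close>, and this stays positive unless \<open>\<beta>\<close> is the simple root itself.
\<close>

lemma simple_reflection_positive:
  assumes i: "i \<in> {1..l}" and \<beta>: "\<beta> \<in> positive_roots" "\<beta> \<noteq> alpha i"
  shows "reflection (alpha i) \<beta> \<in> positive_roots"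
proof -
  have alpha: "alpha i \<in> Phi" "alpha i \<bullet> alpha i \<noteq> 0"
    using alpha_positive[OF i] by (auto simp: positive_roots_def)
  have "reflection (alpha i) \<beta> \<bullet> rho
      = \<beta> \<bullet> rho - (alpha i \<bullet> \<beta>) * (2 * (alpha i \<bullet> rho)) / (alpha i \<bullet> alpha i)"
    by (simp add: reflection_def inner_diff_left)
  also have "\<dots> = \<beta> \<bullet> rho - \<beta> \<bullet> alpha i"
    unfolding alpha_inner_rho[OF i] using alpha(2) by (simp add: inner_commute)
  also have "\<dots> > 0"
  proof (cases "i = l")
    case True
    from \<beta>(1) show ?thesis
      using \<beta>(2) i l_pos unfolding True alpha_last
      by (cases rule: positive_root_cases)
        (auto simp: e_inner e_inner_rho inner_add_left inner_diff_left)
  next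
    case False
    with i have i': "i < l" "Suc i \<in> {1..l}" by auto
    from \<beta>(1) show ?thesis
      using \<beta>(2) i i' unfolding alpha_less[OF i'(1)]
      by (cases rule: positive_root_cases)
        (auto simp: e_inner e_inner_rho inner_add_left inner_diff_left inner_diff_right)
  qed
  moreover have "reflection (alpha i) \<beta> \<in> Phi"
    using \<beta>(1) hyperoctahedral_root[OF reflection_hyperoctahedral[OF alpha(1)]]
    by (simp add: positive_roots_def)
  ultimately show ?thesis by (simp add: positive_roots_def)
qed

lemma finite_positive_roots: "finite positive_roots"
  using finite_roots by (simp add: positive_roots_def)

text \<open>
  A simple reflection permutes the positive roots other than its own root. So multiplying by it moves
  the inversions around, and changes their number only through that one root.
\<close>

lemma inversions_comp_simple:
  assumes w: "w \<in> hyperoctahedral" and i: "i \<in> {1..l}"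
  shows "inversions (w \<circ> reflection (alpha i)) - {alpha i}
    = reflection (alpha i) ` (inversions w - {alpha i})" (is "?L = ?s ` ?R")
proof -
  have \<alpha>: "alpha i \<bullet> alpha i \<noteq> 0" "alpha i \<bullet> rho > 0"
    using alpha_positive[OF i] by (auto simp: positive_roots_def)
  have neq: "?s \<beta> \<noteq> alpha i" if "\<beta> \<in> positive_roots" for \<beta>
  proof
    assume "?s \<beta> = alpha i"
    then have "\<beta> = - alpha i"
      using reflection_reflection[of "alpha i" \<beta>] reflection_self[of "alpha i"] \<alpha>(1) by simp
    then show False using that \<alpha>(2) by (simp add: positive_roots_def)
  qed
  show ?thesis
  proof (intro equalityI subsetI)
    fix \<beta> assume "\<beta> \<in> ?L"
    then have "?s \<beta> \<in> ?R" using simple_reflection_positive[OF i, of \<beta>] neq[of \<beta>]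
      by (auto simp: inversions_def)
    then show "\<beta> \<in> ?s ` ?R" by (rule rev_image_eqI) simp
  next
    fix \<beta> assume "\<beta> \<in> ?s ` ?R"
    then show "\<beta> \<in> ?L" using simple_reflection_positive[OF i] neq
      by (auto simp: inversions_def)
  qed
qed

lemma finite_inversions: "finite (inversions w)"
  using finite_positive_roots by (simp add: inversions_def)

lemma card_inversions_step:
  assumes w: "w \<in> hyperoctahedral" and i: "i \<in> {1..l}"
  shows "card (inversions (w \<circ> reflection (alpha i))) \<le> Suc (card (inversions w))"
proof -
  have "card (inversions (w \<circ> reflection (alpha i))) \<le> Suc (card (inversions (w \<circ> reflection (alpha i)) - {alpha i}))"
    unfolding card_Diff_singleton_if by simp linarith
  also have "\<dots> \<le> Suc (card (inversions w - {alpha i}))"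
    unfolding inversions_comp_simple[OF assms] by (simp add: card_image_le finite_inversions)
  also have "\<dots> \<le> Suc (card (inversions w))"
    by (simp add: card_Diff1_le)
  finally show ?thesis .
qed

lemma card_inversions_descent:
  assumes w: "w \<in> hyperoctahedral" and i: "i \<in> {1..l}" and neg: "w (alpha i) \<bullet> rho < 0"
  shows "card (inversions (w \<circ> reflection (alpha i))) < card (inversions w)"
proof -
  have "w (reflection (alpha i) (alpha i)) \<bullet> rho > 0"
    using neg reflection_self[OF alpha_nonzero[OF i]]
    by (simp add: linear_neg[OF hyperoctahedralD(1)[OF w]])
  then have "alpha i \<notin> inversions (w \<circ> reflection (alpha i))"
    by (auto simp: inversions_def)
  then have "card (inversions (w \<circ> reflection (alpha i))) \<le> card (inversions w - {alpha i})"
    using inversions_comp_simple[OF w i] by (simp add: card_image_le finite_inversions)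
  also have "\<dots> < card (inversions w)"
    using alpha_positive[OF i] neg by (intro card_Diff1_less finite_inversions) (auto simp: inversions_def)
  finally show ?thesis .
qed

text \<open>
  The numbers \<open>v i = w (e i) \<bullet> rho\<close> are nonzero integers between \<open>- l\<close> and \<open>l\<close>. Without descents they
  decrease strictly and stay positive, which leaves only \<open>v i = l + 1 - i = e i \<bullet> rho\<close>.
\<close>

lemma eq_id_of_no_descent:
  assumes w: "w \<in> hyperoctahedral" and pos: "\<And>i. i \<in> {1..l} \<Longrightarrow> w (alpha i) \<bullet> rho > 0"
  shows "w = id"
proof -
  interpret linear w using hyperoctahedralD(1)[OF w] .
  define v where "v i = w (e i) \<bullet> rho" for i
  have v: "\<bar>v i\<bar> \<ge> 1" "v i \<le> real l" "v i \<in> \<int>" if "i \<in> {1..l}" for i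
    using signed_basis_rho[OF hyperoctahedralD(3)[OF w e_signed_basis[OF that]]] by (auto simp: v_def)
  have decr: "v (Suc i) + 1 \<le> v i" if "i \<in> {1..<l}" for i
  proof -
    have "v (Suc i) < v i" using pos[of i] that by (simp add: v_def alpha_less diff inner_diff_left)
    moreover have "v i \<in> \<int>" "v (Suc i) \<in> \<int>" using v that by auto
    ultimately show ?thesis by (auto elim!: Ints_cases)
  qed
  have upper: "i \<in> {1..l} \<Longrightarrow> v i \<le> real l + 1 - real i" for i
  proof (induction i)
    case (Suc i)
    then show ?case using v(2)[of 1] decr[of i] by (cases "i = 0") auto
  qed simp
  have lower: "j < l \<Longrightarrow> v (l - j) \<ge> real j + 1" for j
  proof (induction j)
    case 0
    have "v l > 0" using pos[of l] l_pos by (simp add: v_def alpha_last scale)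
    then show ?case using v(1)[of l] l_pos by auto
  next
    case (Suc j)
    have "l - Suc j \<in> {1..<l}" "Suc (l - Suc j) = l - j" using Suc.prems by auto
    then show ?case using decr[of "l - Suc j"] Suc by simp
  qed
  have "w (e i) = e i" if i: "i \<in> {1..l}" for i
  proof (rule signed_basis_eqI)
    show "w (e i) \<bullet> rho = e i \<bullet> rho"
      using upper[OF i] lower[of "l - i"] i by (simp add: e_inner_rho v_def of_nat_diff)
  qed (use hyperoctahedralD(3)[OF w] e_signed_basis[OF i] in auto)
  then show ?thesis
    using frame_linear_eqI[OF hyperoctahedralD(1)[OF w] linear_id] by simp
qed

lemma ex_descent:
  assumes w: "w \<in> hyperoctahedral" "w \<noteq> id"
  obtains i where "i \<in> {1..l}" "w (alpha i) \<bullet> rho < 0"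
proof -
  have "\<exists>i\<in>{1..l}. \<not> w (alpha i) \<bullet> rho > 0"
    using eq_id_of_no_descent w by blast
  then obtain i where i: "i \<in> {1..l}" "\<not> w (alpha i) \<bullet> rho > 0" by blast
  moreover have "w (alpha i) \<bullet> rho \<noteq> 0"
    using alpha_root[OF i(1)] by (rule root_rho_nonzero[OF hyperoctahedral_root[OF w(1)]])
  ultimately show ?thesis using that[of i] by linarith
qed

text \<open>
  The open Weyl chamber is a fundamental domain: a descent \<open>alpha i\<close> of \<open>w\<close> would have
  \<open>w (alpha i) \<bullet> w x < 0\<close>, although \<open>w\<close> preserves the inner product.
\<close>

lemma eq_id_of_dominant:
  assumes w: "w \<in> hyperoctahedral"
    and x: "\<And>i. i \<in> {1..l} \<Longrightarrow> alpha i \<bullet> x > 0"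
    and wx: "\<And>i. i \<in> {1..l} \<Longrightarrow> alpha i \<bullet> w x > 0"
  shows "w = id"
proof (rule ccontr)
  assume "w \<noteq> id"
  then obtain i where i: "i \<in> {1..l}" "w (alpha i) \<bullet> rho < 0"
    using ex_descent w by blast
  have "w (alpha i) \<in> Phi"
    using alpha_root[OF i(1)] by (rule hyperoctahedral_root[OF w])
  with i wx have "\<not> w (alpha i) \<bullet> w x > 0"
    using dominant_positive_roots_iff[of "w x" "w (alpha i)"] by simp
  with x[OF i(1)] show False by (simp add: hyperoctahedralD(2)[OF w])
qed

lemma simple_reflection_hyperoctahedral: "i \<in> {1..l} \<Longrightarrow> reflection (alpha i) \<in> hyperoctahedral"
  by (intro reflection_hyperoctahedral alpha_root)

lemma word_length_eq_inversions:
  assumes "w \<in> hyperoctahedral"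
  shows "word_length (simple_reflections alpha l) w = card (inversions w)"
proof (rule word_length_eqI[where G = hyperoctahedral])
  show "card (inversions id) = 0"
    by (auto simp: inversions_def positive_roots_def card_eq_0_iff)
  fix w s
  assume w: "w \<in> hyperoctahedral"
  { assume "s \<in> simple_reflections alpha l"
    then obtain i where "i \<in> {1..l}" "s = reflection (alpha i)"
      by (auto simp: simple_reflections_def)
    then show "w \<circ> s \<in> hyperoctahedral \<and> card (inversions (w \<circ> s)) \<le> Suc (card (inversions w))"
      using comp_hyperoctahedral[OF w simple_reflection_hyperoctahedral] card_inversions_step[OF w]
      by blast }
  assume "w \<noteq> id"
  then obtain i where i: "i \<in> {1..l}" "w (alpha i) \<bullet> rho < 0" using ex_descent w by blast
  then show "\<exists>s\<in>simple_reflections alpha l. card (inversions (w \<circ> s)) < card (inversions w)"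
    using card_inversions_descent[OF w] unfolding simple_reflections_def by blast
next
  fix s assume "s \<in> simple_reflections alpha l"
  then obtain i where "s = reflection (alpha i)"
    by (auto simp: simple_reflections_def)
  then show "s \<circ> s = id" by (simp only: reflection_involution)
qed (fact id_hyperoctahedral assms)+

end

section \<open>The Weyl group and its longest elements\<close>

lemma word_closed:
  assumes "set ss \<subseteq> S" "S \<subseteq> G" "id \<in> G" "\<And>v w. v \<in> G \<Longrightarrow> w \<in> G \<Longrightarrow> v \<circ> w \<in> G"
  shows "word ss \<in> G"
  using assms(1)
proof (induction ss)
  case Nil
  show ?case unfolding word_Nil by (rule assms(3))
next
  case (Cons s ss)
  then have "s \<in> G" "word ss \<in> G" using assms(2) by auto
  then show ?case unfolding word_Cons by (rule assms(4))
qed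

context orthonormal_frame
begin

lemma weyl_group_eq: "weyl_group Phi = hyperoctahedral"
proof -
  have eq: "weyl_group Phi = {word ss | ss. set ss \<subseteq> reflection ` Phi}"
    unfolding weyl_group_def
    using generated_group_involutions[of "reflection ` Phi"] reflection_involution by blast
  show ?thesis unfolding eq
  proof (intro equalityI subsetI)
    fix w assume "w \<in> {word ss | ss. set ss \<subseteq> reflection ` Phi}"
    then obtain ss where ss: "w = word ss" "set ss \<subseteq> reflection ` Phi" by blast
    have "reflection ` Phi \<subseteq> hyperoctahedral" using reflection_hyperoctahedral by blast
    from word_closed[OF ss(2) this id_hyperoctahedral comp_hyperoctahedral]
    show "w \<in> hyperoctahedral" unfolding ss(1) .
  next
    fix w assume "w \<in> hyperoctahedral"
    have "\<exists>ss. set ss \<subseteq> reflection ` Phi \<and> length ss \<le> card (inversions w) \<and> w = word ss"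
    proof (rule ex_word_of_descents[where G = hyperoctahedral])
      fix v assume v: "v \<in> hyperoctahedral" "v \<noteq> id"
      then obtain i where i: "i \<in> {1..l}" "v (alpha i) \<bullet> rho < 0" using ex_descent by blast
      have "v \<circ> reflection (alpha i) \<in> hyperoctahedral"
        "card (inversions (v \<circ> reflection (alpha i))) < card (inversions v)"
        using comp_hyperoctahedral[OF v(1) simple_reflection_hyperoctahedral[OF i(1)]]
          card_inversions_descent[OF v(1) i] by blast+
      then show "\<exists>s\<in>reflection ` Phi. v \<circ> s \<in> hyperoctahedral \<and>
          card (inversions (v \<circ> s)) < card (inversions v)"
        using alpha_root[OF i(1)] by blast
    next
      fix s assume "s \<in> reflection ` Phi"
      then show "s \<circ> s = id" using reflection_involution by blast
    qed fact
    then show "w \<in> {word ss | ss. set ss \<subseteq> reflection ` Phi}" by blast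
  qed
qed

text \<open>
  The parabolic subgroup of the simple reflections other than the last one; see \<open>parabolic_eq\<close>.
\<close>

definition basis_permutations :: "('a \<Rightarrow> 'a) set" where
  "basis_permutations = {w \<in> hyperoctahedral. w ` Basis \<subseteq> Basis}"

lemma e_Basis: "i \<in> {1..l} \<Longrightarrow> e i \<in> Basis"
  by (simp add: Basis_eq)

lemma Basis_rho: "b \<in> Basis \<Longrightarrow> b \<bullet> rho > 0"
  unfolding Basis_eq by (elim imageE) (simp add: e_inner_rho)

lemma comp_basis_permutations:
  assumes "v \<in> basis_permutations" "w \<in> basis_permutations"
  shows "v \<circ> w \<in> basis_permutations"
proof -
  have "v \<circ> w \<in> hyperoctahedral"
    using assms by (intro comp_hyperoctahedral) (simp_all add: basis_permutations_def)
  then show ?thesis using assms unfolding basis_permutations_def image_subset_iff comp_apply by blast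
qed

lemma id_basis_permutations: "id \<in> basis_permutations"
  using id_hyperoctahedral by (simp add: basis_permutations_def)

lemma simple_reflection_basis_permutation:
  assumes i: "i \<in> {1..l} - {l}"
  shows "reflection (alpha i) \<in> basis_permutations"
proof -
  have i': "i \<in> {1..l}" "Suc i \<in> {1..l}" "i < l" using i by auto
  have norm: "alpha i \<bullet> alpha i = 2"
    using i' by (simp add: alpha_less inner_diff_left inner_diff_right e_inner)
  have "reflection (alpha i) (e j) \<in> Basis" if j: "j \<in> {1..l}" for j
  proof -
    have "reflection (alpha i) (e j) = e j - (e i \<bullet> e j - e (Suc i) \<bullet> e j) *\<^sub>R (e i - e (Suc i))"
      unfolding reflection_def norm by (simp add: alpha_less[OF i'(3)] inner_diff_left)
    then show ?thesis
      using i' j e_Basis[of i] e_Basis[of j] e_Basis[of "Suc i"]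
      by (cases "j = i"; cases "j = Suc i") (simp_all add: e_inner)
  qed
  then show ?thesis using simple_reflection_hyperoctahedral[OF i'(1)]
    unfolding basis_permutations_def Basis_eq by blast
qed

text \<open>
  A permutation maps \<open>e l\<close> to a basis vector, hence never inverts \<open>alpha l\<close>. The descent that leads to
  the identity therefore uses only the other simple reflections and stays among the permutations.
\<close>

lemma parabolic_eq:
  "generated_group ((\<lambda>i. reflection (alpha i)) ` ({1..l} - {l})) = basis_permutations"
proof -
  let ?S = "(\<lambda>i. reflection (alpha i)) ` ({1..l} - {l})"
  have inv: "s \<circ> s = id" if "s \<in> ?S" for s
    using that reflection_involution by blast
  have eq: "generated_group ?S = {word ss | ss. set ss \<subseteq> ?S}"
    using generated_group_involutions[of ?S] inv by blast
  show ?thesis unfolding eq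
  proof (intro equalityI subsetI)
    fix w assume "w \<in> {word ss | ss. set ss \<subseteq> ?S}"
    then obtain ss where ss: "w = word ss" "set ss \<subseteq> ?S" by blast
    have "?S \<subseteq> basis_permutations" using simple_reflection_basis_permutation by blast
    from word_closed[OF ss(2) this id_basis_permutations comp_basis_permutations]
    show "w \<in> basis_permutations" unfolding ss(1) .
  next
    fix w assume "w \<in> basis_permutations"
    have "\<exists>ss. set ss \<subseteq> ?S \<and> length ss \<le> card (inversions w) \<and> w = word ss"
    proof (rule ex_word_of_descents[where G = basis_permutations])
      fix v assume v: "v \<in> basis_permutations" "v \<noteq> id"
      then have v': "v \<in> hyperoctahedral" by (simp add: basis_permutations_def)
      then obtain i where i: "i \<in> {1..l}" "v (alpha i) \<bullet> rho < 0" using ex_descent v by blast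
      have "i \<noteq> l"
      proof
        assume "i = l"
        moreover have "v (e l) \<in> Basis"
          using v(1) e_Basis[of l] l_pos by (auto simp: basis_permutations_def)
        ultimately show False
          using i(2) Basis_rho[of "v (e l)"]
          by (simp add: alpha_last linear_scale[OF hyperoctahedralD(1)[OF v']])
      qed
      with i have il: "i \<in> {1..l} - {l}" by blast
      have "v \<circ> reflection (alpha i) \<in> basis_permutations"
        "card (inversions (v \<circ> reflection (alpha i))) < card (inversions v)"
        using comp_basis_permutations[OF v(1) simple_reflection_basis_permutation[OF il]]
          card_inversions_descent[OF v' i] by blast+
      then show "\<exists>s\<in>?S. v \<circ> s \<in> basis_permutations \<and>
          card (inversions (v \<circ> s)) < card (inversions v)"
        using il by blast
    qed (fact inv \<open>w \<in> basis_permutations\<close>)+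
    then show "w \<in> {word ss | ss. set ss \<subseteq> ?S}" by blast
  qed
qed

text \<open>
  Negation inverts every positive root. If \<open>v\<close> does so as well, then \<open>- v\<close> has no descent.
\<close>

lemma longest_weyl_group: "longest_element alpha l (weyl_group Phi) = uminus"
  unfolding weyl_group_eq
proof (rule longest_element_eqI)
  have all: "inversions uminus = positive_roots"
    by (auto simp: inversions_def positive_roots_def)
  show "uminus \<in> hyperoctahedral" by (rule uminus_hyperoctahedral)
  fix v assume v: "v \<in> hyperoctahedral"
  have sub: "inversions v \<subseteq> positive_roots" by (auto simp: inversions_def)
  show "word_length (simple_reflections alpha l) v \<le> word_length (simple_reflections alpha l) uminus"
    unfolding word_length_eq_inversions[OF v] word_length_eq_inversions[OF uminus_hyperoctahedral] all
    by (rule card_mono[OF finite_positive_roots sub])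
  assume "word_length (simple_reflections alpha l) v = word_length (simple_reflections alpha l) uminus"
  then have "card (inversions v) = card positive_roots"
    unfolding word_length_eq_inversions[OF v] word_length_eq_inversions[OF uminus_hyperoctahedral] all .
  then have eq: "inversions v = positive_roots"
    by (rule card_subset_eq[OF finite_positive_roots sub])
  have "uminus \<circ> v = id"
  proof (rule eq_id_of_no_descent[OF comp_hyperoctahedral[OF uminus_hyperoctahedral v]])
    fix i assume "i \<in> {1..l}"
    then have "alpha i \<in> inversions v" using alpha_positive eq by blast
    then show "(uminus \<circ> v) (alpha i) \<bullet> rho > 0" by (simp add: inversions_def)
  qed
  then have "- v x = x" for x by (metis comp_apply id_apply)
  then show "v = uminus" by (metis add.inverse_inverse ext)
qed

definition reversal :: "'a \<Rightarrow> 'a" where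
  "reversal x = (\<Sum>i=1..l. (x \<bullet> e (l + 1 - i)) *\<^sub>R e i)"

lemma reversal_inner: "k \<in> {1..l} \<Longrightarrow> reversal x \<bullet> e k = x \<bullet> e (l + 1 - k)"
  unfolding reversal_def by (rule inner_sum_e)

lemma opposite_index: "k \<in> {1..l} \<Longrightarrow> l + 1 - k \<in> {1..l}" "k \<in> {1..l} \<Longrightarrow> l + 1 - (l + 1 - k) = k"
  by auto

lemma reversal_reversal: "reversal (reversal x) = x"
proof (rule frame_eqI)
  fix i assume i: "i \<in> {1..l}"
  show "reversal (reversal x) \<bullet> e i = x \<bullet> e i"
    unfolding reversal_inner[OF i] reversal_inner[OF opposite_index(1)[OF i]] opposite_index(2)[OF i] ..
qed

lemma reversal_e: 
  assumes j: "j \<in> {1..l}"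
  shows "reversal (e j) = e (l + 1 - j)"
proof (rule frame_eqI)
  fix i assume i: "i \<in> {1..l}"
  have "j = l + 1 - i \<longleftrightarrow> l + 1 - j = i" using i j by auto
  then show "reversal (e j) \<bullet> e i = e (l + 1 - j) \<bullet> e i"
    unfolding reversal_inner[OF i] e_inner[OF j opposite_index(1)[OF i]]
      e_inner[OF opposite_index(1)[OF j] i] by (rule if_cong) auto
qed

lemma linear_reversal: "linear reversal"
  unfolding reversal_def[abs_def]
  by (intro linear_compose_sum ballI linearI)
    (simp_all add: inner_add_left scaleR_left_distrib)

lemma frame_inner: "x \<bullet> y = (\<Sum>i=1..l. (x \<bullet> e i) * (y \<bullet> e i))"
proof -
  have "x \<bullet> y = (\<Sum>b\<in>Basis. (x \<bullet> b) * (y \<bullet> b))" by (rule euclidean_inner)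
  also have "\<dots> = (\<Sum>i=1..l. (x \<bullet> e i) * (y \<bullet> e i))"
    by (rule sum.reindex_bij_betw[OF bij_e, symmetric])
  finally show ?thesis .
qed

lemma reversal_inner_reversal: "reversal x \<bullet> reversal y = x \<bullet> y"
proof -
  have "reversal x \<bullet> reversal y = (\<Sum>i=1..l. (reversal x \<bullet> e i) * (reversal y \<bullet> e i))"
    by (rule frame_inner)
  also have "\<dots> = (\<Sum>i=1..l. (x \<bullet> e (l + 1 - i)) * (y \<bullet> e (l + 1 - i)))"
    by (intro sum.cong refl) (simp only: reversal_inner)
  also have "\<dots> = (\<Sum>i=1..l. (x \<bullet> e i) * (y \<bullet> e i))"
    by (subst (2) sum.atLeastAtMost_rev) simp
  also have "\<dots> = x \<bullet> y"
    by (rule frame_inner[symmetric])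
  finally show ?thesis .
qed

lemma reversal_basis_permutations: "reversal \<in> basis_permutations"
proof -
  have B: "reversal (e i) \<in> Basis" if "i \<in> {1..l}" for i
    unfolding reversal_e[OF that] by (rule e_Basis[OF opposite_index(1)[OF that]])
  have "reversal d \<in> signed_basis" if "d \<in> signed_basis" for d
    using that
  proof (cases rule: signed_basisE)
    case (1 i)
    then show ?thesis using B[of i] by (simp add: signed_basis_def Basis_eq)
  next
    case (2 i)
    then show ?thesis using B[of i] 
      by (simp add: linear_neg[OF linear_reversal] uminus_signed_basis signed_basis_def Basis_eq)
  qed
  then have "reversal \<in> hyperoctahedral"
    using linear_reversal reversal_inner_reversal
    unfolding hyperoctahedral_def orthogonal_transformation_def by blast
  then show ?thesis using B unfolding basis_permutations_def Basis_eq by blast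
qed

lemma reversal_rho:
  assumes "b \<in> Basis"
  shows "reversal b \<bullet> rho = real l + 1 - b \<bullet> rho"
proof -
  obtain i where i: "i \<in> {1..l}" "b = e i" using assms unfolding Basis_eq by blast
  then show ?thesis
    using opposite_index(1)[OF i(1)] by (simp add: reversal_e e_inner_rho of_nat_diff)
qed

text \<open>
  A permutation can only invert the roots \<open>e i - e k\<close>, and the reversal inverts all of them. If \<open>v\<close>
  inverts all of them, then its composition with the reversal has no descent.
\<close>

lemma longest_parabolic:
  "longest_element alpha l (generated_group ((\<lambda>i. reflection (alpha i)) ` ({1..l} - {l}))) = reversal"
  unfolding parabolic_eq
proof (rule longest_element_eqI)
  show rev: "reversal \<in> basis_permutations" by (rule reversal_basis_permutations)
  then have rev': "reversal \<in> hyperoctahedral" by (simp add: basis_permutations_def)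
  fix v assume v: "v \<in> basis_permutations"
  then have v': "v \<in> hyperoctahedral" and vB: "\<And>i. i \<in> {1..l} \<Longrightarrow> v (e i) \<in> Basis"
    using e_Basis unfolding basis_permutations_def by blast+
  interpret v: linear v using hyperoctahedralD(1)[OF v'] .
  interpret r: linear reversal by (rule linear_reversal)
  have sub: "inversions v \<subseteq> inversions reversal"
  proof
    fix \<beta> assume "\<beta> \<in> inversions v"
    then have \<beta>: "\<beta> \<in> positive_roots" "v \<beta> \<bullet> rho < 0" by (auto simp: inversions_def)
    from \<beta>(1) show "\<beta> \<in> inversions reversal"
    proof (cases rule: positive_root_cases)
      case (diff i k)
      then have "reversal \<beta> \<bullet> rho < 0"
        by (simp add: r.diff inner_diff_left reversal_rho e_Basis e_inner_rho)
      then show ?thesis using \<beta>(1) by (simp add: inversions_def)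
    next
      case (sum i k)
      then show ?thesis using \<beta>(2) Basis_rho[OF vB[of i]] Basis_rho[OF vB[of k]]
        by (simp add: v.add inner_add_left)
    next
      case (double k)
      then show ?thesis using \<beta>(2) Basis_rho[OF vB[of k]]
        by (simp add: v.scale)
    qed
  qed
  show "word_length (simple_reflections alpha l) v \<le> word_length (simple_reflections alpha l) reversal"
    unfolding word_length_eq_inversions[OF v'] word_length_eq_inversions[OF rev']
    by (rule card_mono[OF finite_inversions sub])
  assume "word_length (simple_reflections alpha l) v = word_length (simple_reflections alpha l) reversal"
  then have "card (inversions v) = card (inversions reversal)"
    unfolding word_length_eq_inversions[OF v'] word_length_eq_inversions[OF rev'] .
  then have eq: "inversions v = inversions reversal"
    by (rule card_subset_eq[OF finite_inversions sub])
  have "reversal \<circ> v = id"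
  proof (rule eq_id_of_no_descent[OF comp_hyperoctahedral[OF rev' v']])
    fix i assume i: "i \<in> {1..l}"
    show "(reversal \<circ> v) (alpha i) \<bullet> rho > 0"
    proof (cases "i = l")
      case True
      have "reversal (v (e l)) \<in> Basis" using rev vB[of l] i True unfolding basis_permutations_def by blast
      then show ?thesis using True Basis_rho by (simp add: alpha_last v.scale r.scale)
    next
      case False
      with i have i': "i < l" "Suc i \<in> {1..l}" by auto
      have "alpha i \<in> inversions reversal"
        using i i' alpha_positive[OF i]
        by (simp add: inversions_def alpha_less r.diff inner_diff_left reversal_rho e_Basis e_inner_rho)
      then have "v (alpha i) \<bullet> rho < 0" unfolding eq[symmetric] by (simp add: inversions_def)
      then show ?thesis
        using vB[OF i] vB[OF i'(2)] i'(1)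
        by (simp add: alpha_less v.diff r.diff inner_diff_left reversal_rho)
    qed
  qed
  then have "reversal (v x) = x" for x by (metis comp_apply id_apply)
  then show "v = reversal" by (metis reversal_reversal ext)
qed

lemma omega_eq: "omega Phi alpha l l = reversal \<circ> uminus"
  using l_pos unfolding omega_def longest_weyl_group longest_parabolic by simp

end

section \<open>The alcove and its stabilizer\<close>

context orthonormal_frame
begin

text \<open>
  The differences that the definition of the highest root allows.
\<close>

definition positive_cone :: "'a set" where
  "positive_cone = {x. \<exists>c::nat \<Rightarrow> nat. x = (\<Sum>i=1..l. real (c i) *\<^sub>R alpha i)}"

lemma zero_cone: "0 \<in> positive_cone"
  unfolding positive_cone_def by (intro CollectI exI[of _ "\<lambda>_. 0"]) simp

lemma add_cone:
  assumes "x \<in> positive_cone" "y \<in> positive_cone"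
  shows "x + y \<in> positive_cone"
proof -
  obtain c d :: "nat \<Rightarrow> nat" where "x = (\<Sum>i=1..l. real (c i) *\<^sub>R alpha i)"
    "y = (\<Sum>i=1..l. real (d i) *\<^sub>R alpha i)"
    using assms unfolding positive_cone_def by blast
  then have "x + y = (\<Sum>i=1..l. real (c i + d i) *\<^sub>R alpha i)"
    by (simp add: sum.distrib scaleR_left_distrib)
  then show ?thesis
    unfolding positive_cone_def by (intro CollectI exI[of _ "\<lambda>i. c i + d i"])
qed

lemma alpha_cone:
  assumes "i \<in> {1..l}"
  shows "alpha i \<in> positive_cone"
proof -
  have "(\<Sum>j=1..l. real (if j = i then 1 else 0) *\<^sub>R alpha j) = (\<Sum>j=1..l. if j = i then alpha j else 0)"
    by (rule sum.cong) auto
  also have "\<dots> = alpha i" using assms by simp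
  finally show ?thesis unfolding positive_cone_def by (intro CollectI exI) (rule sym)
qed

lemma diff_cone:
  assumes i: "1 \<le> i"
  shows "i \<le> k \<Longrightarrow> k \<le> l \<Longrightarrow> e i - e k \<in> positive_cone"
proof (induction k)
  case (Suc k)
  show ?case
  proof (cases "i = Suc k")
    case True
    then show ?thesis using zero_cone by simp
  next
    case False
    then have "e i - e k \<in> positive_cone" using Suc by simp
    moreover have "alpha k \<in> positive_cone" using False Suc.prems i by (intro alpha_cone) auto
    ultimately have "(e i - e k) + alpha k \<in> positive_cone" by (rule add_cone)
    then show ?thesis using Suc.prems by (simp add: alpha_less)
  qed
qed (use i in simp)

lemma first_minus_signed_basis_cone:
  assumes "d \<in> signed_basis"
  shows "e 1 - d \<in> positive_cone"
  using assms
proof (cases rule: signed_basisE)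
  case (1 i)
  then show ?thesis using diff_cone[of 1 i] by simp
next
  case (2 i)
  have "(e 1 - e l) + ((e i - e l) + alpha l) \<in> positive_cone"
    using 2 l_pos by (intro add_cone diff_cone alpha_cone) auto
  also have "(e 1 - e l) + ((e i - e l) + alpha l) = e 1 - d"
    using 2 by (simp add: alpha_last scaleR_2)
  finally show ?thesis .
qed

lemma cone_antisym:
  assumes "x \<in> positive_cone" "- x \<in> positive_cone"
  shows "x = 0"
proof -
  have nonneg: "y \<bullet> rho \<ge> 0" "y \<bullet> rho = 0 \<Longrightarrow> y = 0" if y_cone: "y \<in> positive_cone" for y
  proof -
    obtain c :: "nat \<Rightarrow> nat" where y: "y = (\<Sum>i=1..l. real (c i) *\<^sub>R alpha i)"
      using y_cone unfolding positive_cone_def by blast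
    have pos: "alpha i \<bullet> rho > 0" if "i \<in> {1..l}" for i
      using alpha_positive[OF that] by (simp add: positive_roots_def)
    have eq: "y \<bullet> rho = (\<Sum>i=1..l. real (c i) * (alpha i \<bullet> rho))"
      by (simp add: y inner_sum_left)
    have terms: "real (c i) * (alpha i \<bullet> rho) \<ge> 0" if "i \<in> {1..l}" for i
      using pos[OF that] by simp
    show "y \<bullet> rho \<ge> 0" unfolding eq by (rule sum_nonneg[OF terms])
    assume "y \<bullet> rho = 0"
    then have "\<forall>i\<in>{1..l}. real (c i) * (alpha i \<bullet> rho) = 0"
      unfolding eq using sum_nonneg_eq_0_iff[of "{1..l}" "\<lambda>i. real (c i) * (alpha i \<bullet> rho)"] terms by simp
    then have "real (c i) = 0" if "i \<in> {1..l}" for i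
      using pos[OF that] that by (metis less_irrefl mult_eq_0_iff)
    then show "y = 0" unfolding y by (intro sum.neutral) simp
  qed
  have "x \<bullet> rho = 0" using nonneg(1)[OF assms(1)] nonneg(1)[OF assms(2)] by simp
  then show ?thesis by (rule nonneg(2)[OF assms(1)])
qed

lemma highest_root_eq: "highest_root Phi alpha l = 2 *\<^sub>R e 1"
  unfolding highest_root_def
proof (rule the_equality)
  have max: "2 *\<^sub>R e 1 - \<beta> \<in> positive_cone" if root: "\<beta> \<in> Phi" for \<beta>
  proof -
    obtain a b where ab: "a \<in> signed_basis" "b \<in> signed_basis" "\<beta> = a + b"
      using root unfolding roots_eq by blast
    have "(e 1 - a) + (e 1 - b) \<in> positive_cone"
      by (intro add_cone first_minus_signed_basis_cone ab(1,2))
    then show ?thesis by (simp add: ab(3) scaleR_2 algebra_simps)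
  qed
  have root: "2 *\<^sub>R e 1 \<in> Phi"
    using l_pos unfolding root_iff by (intro disjI2 bexI[of _ 1] disjI1) auto
  show "2 *\<^sub>R e 1 \<in> Phi \<and> (\<forall>\<beta>\<in>Phi. \<exists>c::nat \<Rightarrow> nat. 2 *\<^sub>R e 1 - \<beta> = (\<Sum>i=1..l. real (c i) *\<^sub>R alpha i))"
    using root max unfolding positive_cone_def by blast
  fix \<gamma>
  assume \<gamma>: "\<gamma> \<in> Phi \<and> (\<forall>\<beta>\<in>Phi. \<exists>c::nat \<Rightarrow> nat. \<gamma> - \<beta> = (\<Sum>i=1..l. real (c i) *\<^sub>R alpha i))"
  then have "\<gamma> - 2 *\<^sub>R e 1 \<in> positive_cone" using root unfolding positive_cone_def by blast
  moreover have "- (\<gamma> - 2 *\<^sub>R e 1) \<in> positive_cone" using max[of \<gamma>] \<gamma> by simp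
  ultimately show "\<gamma> = 2 *\<^sub>R e 1" using cone_antisym[of "\<gamma> - 2 *\<^sub>R e 1"] by simp
qed

abbreviation "Z \<equiv> coweight_lattice Phi"

lemma coweight_zero: "0 \<in> Z"
  by (simp add: coweight_lattice_def)

lemma coweight_add: "x \<in> Z \<Longrightarrow> y \<in> Z \<Longrightarrow> x + y \<in> Z"
  by (simp add: coweight_lattice_def inner_add_right)

lemma coweight_uminus: "x \<in> Z \<Longrightarrow> - x \<in> Z"
  by (simp add: coweight_lattice_def)

text \<open>
  In doubled coordinates the coweight lattice consists of the integer vectors whose entries have the
  same parity: every root is a sum of two signed basis vectors, so it takes the value of half a sum of
  two entries up to sign.
\<close>

lemma coweightI:
  assumes u: "\<And>i. i \<in> {1..l} \<Longrightarrow> x \<bullet> e i = of_int (u i) / 2"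
    and parity: "\<And>i k. i \<in> {1..l} \<Longrightarrow> k \<in> {1..l} \<Longrightarrow> even (u i - u k)"
  shows "x \<in> Z"
  unfolding coweight_lattice_def
proof (intro CollectI ballI)
  fix \<beta> assume "\<beta> \<in> Phi"
  then obtain a b where ab: "a \<in> signed_basis" "b \<in> signed_basis" "\<beta> = a + b"
    unfolding roots_eq by blast
  have D: "\<exists>m. d \<bullet> x = of_int m / 2 \<and> even (m - u 1)" if "d \<in> signed_basis" for d
    using that
  proof (cases rule: signed_basisE)
    case (1 i)
    then have "d \<bullet> x = of_int (u i) / 2" "even (u i - u 1)"
      using u[of i] parity[of i 1] l_pos by (auto simp: inner_commute)
    then show ?thesis by blast
  next
    case (2 i)
    then have "d \<bullet> x = of_int (- u i) / 2" "even (- u i - u 1)"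
      using u[of i] parity[of i 1] l_pos by (auto simp: inner_commute)
    then show ?thesis by blast
  qed
  obtain m where m: "a \<bullet> x = of_int m / 2" "even (m - u 1)" using D[OF ab(1)] by blast
  obtain n where n: "b \<bullet> x = of_int n / 2" "even (n - u 1)" using D[OF ab(2)] by blast
  have "even (m + n)" using m(2) n(2) by simp
  then obtain k where "m + n = 2 * k" by (rule evenE)
  then have "real_of_int m + real_of_int n = 2 * real_of_int k" by linarith
  then have "\<beta> \<bullet> x = of_int k"
    using m(1) n(1) by (simp add: ab(3) inner_add_left)
  then show "\<beta> \<bullet> x \<in> \<int>" by simp
qed

lemma coweightE:
  assumes "x \<in> Z"
  obtains u where "\<And>i. i \<in> {1..l} \<Longrightarrow> x \<bullet> e i = of_int (u i) / 2"
    "\<And>i k. i \<in> {1..l} \<Longrightarrow> k \<in> {1..l} \<Longrightarrow> even (u i - u k)"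
proof -
  have int: "\<beta> \<bullet> x \<in> \<int>" if "\<beta> \<in> Phi" for \<beta>
    using assms that unfolding coweight_lattice_def by blast
  define u where "u i = \<lfloor>2 * (x \<bullet> e i)\<rfloor>" for i
  have u: "x \<bullet> e i = of_int (u i) / 2" if i: "i \<in> {1..l}" for i
  proof -
    have "2 *\<^sub>R e i \<in> Phi" using i unfolding root_iff by blast
    from int[OF this] have "2 * (x \<bullet> e i) \<in> \<int>" by (simp add: inner_commute)
    then have "of_int (u i) = 2 * (x \<bullet> e i)" unfolding u_def by (rule of_int_floor)
    then show ?thesis by simp
  qed
  have "even (u i - u k)" if ik: "i \<in> {1..l}" "k \<in> {1..l}" for i k
  proof (cases "i = k")
    case False
    have "e i + e k \<in> Phi"
      using ik False by (intro rootI e_signed_basis signed_basis_add_nonzero) (auto simp: e_inner)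
    from int[OF this] have "(x \<bullet> e i) + (x \<bullet> e k) \<in> \<int>"
      by (simp only: inner_commute[of _ x] inner_add_right)
    then obtain m where "of_int (u i) / 2 + of_int (u k) / 2 = real_of_int m"
      unfolding u[OF ik(1)] u[OF ik(2)] by (rule Ints_cases)
    then have "real_of_int (u i + u k) = real_of_int (2 * m)" by simp
    then have "u i + u k = 2 * m" by linarith
    then show ?thesis by presburger
  qed simp
  with u that show ?thesis by blast
qed

lemma hyperoctahedral_surj_roots:
  assumes w: "w \<in> hyperoctahedral"
  shows "w ` Phi = Phi" "w ` signed_basis = signed_basis"
proof -
  have inj: "inj w" using w unfolding hyperoctahedral_def by (simp add: orthogonal_transformation_inj)
  show "w ` Phi = Phi"
    by (rule endo_inj_surj[OF finite_roots]) (use inj hyperoctahedral_root[OF w] in \<open>auto intro: inj_on_subset\<close>)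
  have "finite signed_basis" by (simp add: signed_basis_def)
  then show "w ` signed_basis = signed_basis"
    by (rule endo_inj_surj) (use inj hyperoctahedralD(3)[OF w] in \<open>auto intro: inj_on_subset\<close>)
qed

lemma hyperoctahedral_coweight_iff:
  assumes w: "w \<in> hyperoctahedral"
  shows "w x \<in> Z \<longleftrightarrow> x \<in> Z"
proof -
  have "w x \<in> Z \<longleftrightarrow> (\<forall>\<beta>\<in>w ` Phi. \<beta> \<bullet> w x \<in> \<int>)"
    unfolding hyperoctahedral_surj_roots(1)[OF w] coweight_lattice_def by simp
  also have "\<dots> \<longleftrightarrow> x \<in> Z"
    by (simp add: coweight_lattice_def hyperoctahedralD(2)[OF w])
  finally show ?thesis .
qed

lemma hyperoctahedral_coset:
  assumes w: "w \<in> hyperoctahedral"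
  shows "w ` lattice_coset Phi q x = lattice_coset Phi q (w x)"
proof -
  interpret linear w by (rule hyperoctahedralD(1)[OF w])
  have surj: "surj w" using w unfolding hyperoctahedral_def by (simp add: orthogonal_transformation_surj)
  show ?thesis
  proof (intro equalityI subsetI)
    fix y assume "y \<in> w ` lattice_coset Phi q x"
    then obtain z where z: "z \<in> Z" "y = w (x + real q *\<^sub>R z)" unfolding lattice_coset_def by blast
    then have "y = w x + real q *\<^sub>R w z" "w z \<in> Z"
      by (simp_all add: add scale hyperoctahedral_coweight_iff[OF w])
    then show "y \<in> lattice_coset Phi q (w x)" unfolding lattice_coset_def by blast
  next
    fix y assume "y \<in> lattice_coset Phi q (w x)"
    then obtain z where z: "z \<in> Z" "y = w x + real q *\<^sub>R z" unfolding lattice_coset_def by blast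
    obtain z' where z': "z = w z'" using surj by (metis surjD)
    have "z' \<in> Z" using z(1) hyperoctahedral_coweight_iff[OF w] unfolding z' by blast
    moreover have "y = w (x + real q *\<^sub>R z')" unfolding z(2) z' by (simp add: add scale)
    ultimately show "y \<in> w ` lattice_coset Phi q x" unfolding lattice_coset_def by blast
  qed
qed

lemma coset_eq_iff:
  "lattice_coset Phi q x = lattice_coset Phi q y \<longleftrightarrow> (\<exists>z\<in>Z. x = y + real q *\<^sub>R z)" (is "?L \<longleftrightarrow> ?R")
proof
  assume ?L
  have "x = x + real q *\<^sub>R 0" by simp
  then have "x \<in> lattice_coset Phi q x" using coweight_zero unfolding lattice_coset_def by blast
  then show ?R unfolding \<open>?L\<close> unfolding lattice_coset_def by blast
next
  have sub: "lattice_coset Phi q (y + real q *\<^sub>R z) \<subseteq> lattice_coset Phi q y" if "z \<in> Z" for y z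
  proof
    fix v assume "v \<in> lattice_coset Phi q (y + real q *\<^sub>R z)"
    then obtain t where "t \<in> Z" "v = (y + real q *\<^sub>R z) + real q *\<^sub>R t"
      unfolding lattice_coset_def by blast
    then have "v = y + real q *\<^sub>R (z + t)" "z + t \<in> Z"
      using that by (simp_all add: scaleR_right_distrib coweight_add add.assoc)
    then show "v \<in> lattice_coset Phi q y" unfolding lattice_coset_def by blast
  qed
  assume ?R
  then obtain z where z: "z \<in> Z" "x = y + real q *\<^sub>R z" by blast
  have "y = x + real q *\<^sub>R (- z)" using z(2) by simp
  then show ?L using sub[OF z(1), of y] sub[OF coweight_uminus[OF z(1)], of x] z(2) by simp
qed

abbreviation "alcove \<equiv> fundamental_alcove Phi alpha l"

lemma alcove_iff: "x \<in> alcove \<longleftrightarrow> (\<forall>i\<in>{1..l}. alpha i \<bullet> x > 0) \<and> x \<bullet> e 1 < 1 / 2"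
  unfolding fundamental_alcove_def highest_root_eq by (auto simp: inner_commute)

lemma alcove_bounds:
  assumes x: "x \<in> alcove" and k: "k \<in> {1..l}"
  shows "0 < x \<bullet> e k" "x \<bullet> e k < 1 / 2"
proof -
  have pos: "\<beta> \<bullet> x > 0" if "\<beta> \<in> positive_roots" for \<beta>
  proof (rule dominant_positive[OF _ _ that])
    show "linear (\<lambda>\<beta>. \<beta> \<bullet> x)" by (simp add: linear_iff inner_add_left)
  qed (use x in \<open>simp add: alcove_iff\<close>)
  have "2 *\<^sub>R e k \<in> Phi" using k unfolding root_iff by blast
  then have "2 *\<^sub>R e k \<in> positive_roots" using k by (simp add: positive_roots_def e_inner_rho)
  from pos[OF this] show "0 < x \<bullet> e k" by (simp add: inner_commute)
  show "x \<bullet> e k < 1 / 2"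
  proof (cases "k = 1")
    case True
    then show ?thesis using x by (simp add: alcove_iff)
  next
    case False
    then have "e 1 - e k \<in> Phi" using k unfolding root_iff
      by (rule_tac disjI1, rule_tac bexI[of _ k], rule_tac bexI[of _ 1]) simp_all
    then have "e 1 - e k \<in> positive_roots"
      using k False by (simp add: positive_roots_def e_inner_rho inner_diff_left)
    from pos[OF this] have "x \<bullet> e k < x \<bullet> e 1"
      by (simp only: inner_commute[of _ x] inner_diff_right diff_gt_0_iff_gt)
    then show ?thesis using x by (simp add: alcove_iff)
  qed
qed

definition half :: 'a where "half = (\<Sum>i=1..l. (1 / 2) *\<^sub>R e i)"

lemma half_inner: "k \<in> {1..l} \<Longrightarrow> half \<bullet> e k = 1 / 2"
  unfolding half_def by (rule inner_sum_e)

lemma half_coweight: "half \<in> Z"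
  by (rule coweightI[where u = "\<lambda>_. 1"]) (simp_all add: half_inner)

abbreviation "minus_reversal \<equiv> reversal \<circ> uminus"

lemma minus_reversal_inner: "k \<in> {1..l} \<Longrightarrow> minus_reversal x \<bullet> e k = - (x \<bullet> e (l + 1 - k))"
  by (simp add: reversal_inner)

lemma minus_reversal_hyperoctahedral: "minus_reversal \<in> hyperoctahedral"
  using reversal_basis_permutations uminus_hyperoctahedral
  unfolding basis_permutations_def by (blast intro: comp_hyperoctahedral)

lemma minus_reversal_involution: "minus_reversal (minus_reversal x) = x"
  by (simp add: linear_neg[OF linear_reversal] reversal_reversal)

lemma alpha_inner: 
  assumes "i \<in> {1..l}"
  shows "alpha i \<bullet> x = (if i = l then 2 * (x \<bullet> e l) else x \<bullet> e i - x \<bullet> e (Suc i))"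
  using assms by (simp add: alpha_last alpha_less inner_commute[of _ x] inner_diff_right)

text \<open>
  In coordinates this is the map \<open>x\<^sub>k \<mapsto> 1/2 - x\<^bsub>l + 1 - k\<^esub>\<close>. It reverses the chain of inequalities
  \<open>1/2 > x\<^sub>1 > \<dots> > x\<^sub>l > 0\<close> that defines the alcove.
\<close>

lemma alcove_flip:
  assumes x: "x \<in> alcove"
  shows "minus_reversal x + half \<in> alcove"
proof -
  let ?y = "minus_reversal x + half"
  have y: "?y \<bullet> e k = 1 / 2 - x \<bullet> e (l + 1 - k)" if "k \<in> {1..l}" for k
    using minus_reversal_inner[OF that] half_inner[OF that] by (simp only: inner_add_left)
  have "alpha i \<bullet> ?y > 0" if i: "i \<in> {1..l}" for i
  proof (cases "i = l")
    case True
    then show ?thesis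
      using y[OF i] alcove_bounds(2)[OF x, of 1] l_pos unfolding alpha_inner[OF i] by simp
  next
    case False
    with i have i': "Suc i \<in> {1..l}" "l - i \<in> {1..l}" "l - i \<noteq> l" "Suc (l - i) = l + 1 - i" "l + 1 - Suc i = l - i"
      by auto
    have "alpha (l - i) \<bullet> x > 0" using x i' unfolding alcove_iff by blast
    then have "x \<bullet> e (l - i) > x \<bullet> e (l + 1 - i)"
      unfolding alpha_inner[OF i'(2)] using i'(3,4) by simp
    then show ?thesis
      using False unfolding alpha_inner[OF i] y[OF i] y[OF i'(1)] i'(5) by simp
  qed
  moreover have "?y \<bullet> e 1 < 1 / 2"
    using y[of 1] alcove_bounds(1)[OF x, of l] l_pos by simp
  ultimately show ?thesis unfolding alcove_iff by blast
qed

lemma alcove_nonempty: "(1 / (2 * real l + 2)) *\<^sub>R rho \<in> alcove"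
  unfolding alcove_iff
proof (intro conjI ballI)
  fix i assume i: "i \<in> {1..l}"
  then show "0 < alpha i \<bullet> (1 / (2 * real l + 2)) *\<^sub>R rho"
    using alpha_positive[OF i] by (simp add: positive_roots_def)
next
  have "rho \<bullet> e 1 = real l" using l_pos e_inner_rho[of 1] by (simp add: inner_commute)
  then show "(1 / (2 * real l + 2)) *\<^sub>R rho \<bullet> e 1 < 1 / 2" by (simp add: field_simps)
qed

text \<open>
  Let \<open>w x = y + z\<close> with \<open>x\<close>, \<open>y\<close> in the alcove and \<open>z\<close> in the lattice. The coordinates of \<open>w x\<close> are up
  to sign those of \<open>x\<close>, which bounds them by 1/2, and those of \<open>y\<close> lie between 0 and 1/2. So the doubled
  coordinates of \<open>z\<close> are 0 or -1, all equal by parity.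
\<close>

theorem alcove_stabilizer_eq: "alcove_stabilizer Phi alpha l = {id, minus_reversal}"
proof -
  let ?c = "lattice_coset Phi 1"
  have image: "(\<lambda>t. w ` t) ` ?c ` alcove = (\<lambda>x. ?c (w x)) ` alcove" if "w \<in> hyperoctahedral" for w
    by (simp only: image_image hyperoctahedral_coset[OF that])
  have mem: "w \<in> alcove_stabilizer Phi alpha l \<longleftrightarrow>
      w \<in> hyperoctahedral \<and> (\<lambda>x. ?c (w x)) ` alcove = ?c ` alcove" for w
    unfolding alcove_stabilizer_def weyl_group_eq mem_Collect_eq
    by (intro conj_cong refl) (simp only: image)
  show ?thesis
  proof (intro equalityI subsetI)
    fix w assume "w \<in> alcove_stabilizer Phi alpha l"
    then have w: "w \<in> hyperoctahedral" and stab: "(\<lambda>x. ?c (w x)) ` alcove = ?c ` alcove"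
      unfolding mem by simp_all
    obtain x where x: "x \<in> alcove" using alcove_nonempty by blast
    then have "?c (w x) \<in> ?c ` alcove" using stab by blast
    then obtain y where y: "y \<in> alcove" "?c (w x) = ?c y" by blast
    then obtain z where z: "z \<in> Z" "w x = y + z" unfolding coset_eq_iff by auto
    obtain u where u: "\<And>i. i \<in> {1..l} \<Longrightarrow> z \<bullet> e i = of_int (u i) / 2"
      and parity: "\<And>i k. i \<in> {1..l} \<Longrightarrow> k \<in> {1..l} \<Longrightarrow> even (u i - u k)"
      using coweightE[OF z(1)] by blast
    have bound: "\<bar>w x \<bullet> e k\<bar> < 1 / 2" if k: "k \<in> {1..l}" for k
    proof -
      obtain d where d: "d \<in> signed_basis" "e k = w d"
        using e_signed_basis[OF k] hyperoctahedral_surj_roots(2)[OF w] by (metis imageE)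
      have eq: "w x \<bullet> e k = x \<bullet> d" unfolding d(2) by (rule hyperoctahedralD(2)[OF w])
      from d(1) show ?thesis unfolding eq
        by (cases rule: signed_basisE) (use alcove_bounds[OF x] in \<open>force+\<close>)
    qed
    have u01: "u k = 0 \<or> u k = -1" if k: "k \<in> {1..l}" for k
    proof -
      have "w x \<bullet> e k = y \<bullet> e k + of_int (u k) / 2" unfolding z(2) inner_add_left u[OF k] ..
      then have "-2 < real_of_int (u k)" "real_of_int (u k) < 1"
        using bound[OF k] alcove_bounds[OF y(1) k] by linarith+
      then show ?thesis by linarith
    qed
    have one: "1 \<in> {1..l}" using l_pos by simp
    consider "u 1 = 0" | "u 1 = - 1" using u01[OF one] by blast
    then show "w \<in> {id, minus_reversal}"
    proof cases
      case 1
      have "z = 0"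
      proof (rule frame_eqI)
        fix i assume i: "i \<in> {1..l}"
        have "u i = 0" using u01[OF i] parity[OF i one] 1 by auto
        then show "z \<bullet> e i = 0 \<bullet> e i" using u[OF i] by simp
      qed
      then have "w x \<in> alcove" using y z(2) by simp
      then have "w = id" using x by (intro eq_id_of_dominant[OF w, of x]) (simp_all add: alcove_iff)
      then show ?thesis by blast
    next
      case 2
      have zh: "z = - half"
      proof (rule frame_eqI)
        fix i assume i: "i \<in> {1..l}"
        have "u i = -1" using u01[OF i] parity[OF i one] 2 by auto
        then show "z \<bullet> e i = (- half) \<bullet> e i" using u[OF i] half_inner[OF i] by simp
      qed
      have "minus_reversal (- half) = half"
      proof (rule frame_eqI)
        fix i assume i: "i \<in> {1..l}"
        show "minus_reversal (- half) \<bullet> e i = half \<bullet> e i"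
          using half_inner[OF i] half_inner[OF opposite_index(1)[OF i]]
          by (simp only: minus_reversal_inner[OF i] inner_minus_left minus_minus)
      qed
      then have "minus_reversal (w x) = minus_reversal y + half"
        unfolding z(2) zh using linear_add[OF hyperoctahedralD(1)[OF minus_reversal_hyperoctahedral]] by metis
      then have "minus_reversal (w x) \<in> alcove" using alcove_flip[OF y(1)] by simp
      then have "(minus_reversal \<circ> w) x \<in> alcove" by (simp only: comp_apply)
      then have "minus_reversal \<circ> w = id"
        using x by (intro eq_id_of_dominant[OF comp_hyperoctahedral[OF minus_reversal_hyperoctahedral w], of x])
          (simp_all only: alcove_iff)
      then have "minus_reversal (w v) = v" for v by (metis comp_apply id_apply)
      then have "w = minus_reversal" by (metis minus_reversal_involution ext)
      then show ?thesis by blast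
    qed
  next
    fix w assume "w \<in> {id, minus_reversal}"
    then consider "w = id" | "w = minus_reversal" by blast
    then show "w \<in> alcove_stabilizer Phi alpha l"
    proof cases
      case 1
      then show ?thesis using id_hyperoctahedral unfolding mem by simp
    next
      case 2
      have flip: "?c (minus_reversal x) = ?c (minus_reversal x + half)" for x
      proof -
        have "minus_reversal x = (minus_reversal x + half) + real 1 *\<^sub>R (- half)" by simp
        then show ?thesis unfolding coset_eq_iff using coweight_uminus[OF half_coweight] by blast
      qed
      have "(\<lambda>x. ?c (minus_reversal x)) ` alcove = ?c ` alcove"
      proof (intro equalityI subsetI)
        fix t assume "t \<in> (\<lambda>x. ?c (minus_reversal x)) ` alcove"
        then show "t \<in> ?c ` alcove" using flip alcove_flip by blast
      next
        fix t assume "t \<in> ?c ` alcove"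
        then obtain x where x: "x \<in> alcove" "t = ?c x" by blast
        have "t = minus_reversal ` ?c (minus_reversal x)"
          unfolding x(2) hyperoctahedral_coset[OF minus_reversal_hyperoctahedral] minus_reversal_involution ..
        also have "\<dots> = ?c (minus_reversal (minus_reversal x + half))"
          unfolding flip hyperoctahedral_coset[OF minus_reversal_hyperoctahedral] ..
        finally show "t \<in> (\<lambda>x. ?c (minus_reversal x)) ` alcove" using alcove_flip[OF x(1)] by blast
      qed
      then show ?thesis
        unfolding 2 mem using minus_reversal_hyperoctahedral by blast
    qed
  qed
qed

end

section \<open>Sequences of inequivalent residues\<close>

text \<open>
  The entries are chosen one after the other, and each choice removes one class of \<open>c\<close> elements from
  what is left. The factors are integers because they may become negative; this happens only
  after a factor has vanished. The set \<open>X0\<close> for the first entry will encode the normalization of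
  cosets.
\<close>

lemma card_inequivalent_sequences:
  fixes X :: "'b set" and R :: "'b \<Rightarrow> 'b \<Rightarrow> bool"
  assumes fin: "finite X" and X0: "X0 \<subseteq> X"
    and R: "\<And>x y z. x \<in> X \<Longrightarrow> y \<in> X \<Longrightarrow> z \<in> X \<Longrightarrow> R x z \<Longrightarrow> R y z \<Longrightarrow> R x y"
    and c: "\<And>x. x \<in> X \<Longrightarrow> card {y \<in> X. R x y} = c"
  shows "int (card {f \<in> {1..Suc n} \<rightarrow>\<^sub>E X.
      f 1 \<in> X0 \<and> (\<forall>k\<in>{1..Suc n}. \<forall>i\<in>{1..<k}. \<not> R (f i) (f k))})
    = int (card X0) * (\<Prod>i=1..n. int (card X) - int c * int i)"
proof -
  define S where "S n = {f \<in> {1..n} \<rightarrow>\<^sub>E X.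
    f 1 \<in> X0 \<and> (\<forall>k\<in>{1..n}. \<forall>i\<in>{1..<k}. \<not> R (f i) (f k))}" for n :: nat
  have "int (card (S (Suc n))) = int (card X0) * (\<Prod>i=1..n. int (card X) - int c * int i)"
  proof (induction n)
    case 0
    have "bij_betw (\<lambda>x. (\<lambda>i. if i = Suc 0 then x else undefined)) X0 (S (Suc 0))"
    proof (rule bij_betw_byWitness[where f' = "\<lambda>f. f (Suc 0)"])
      show "\<forall>f\<in>S (Suc 0). (\<lambda>i. if i = Suc 0 then f (Suc 0) else undefined) = f"
        by (auto simp: S_def PiE_def extensional_def fun_eq_iff)
      show "(\<lambda>x i. if i = Suc 0 then x else undefined) ` X0 \<subseteq> S (Suc 0)"
        using X0 by (auto simp: S_def PiE_def extensional_def)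
      show "(\<lambda>f. f (Suc 0)) ` S (Suc 0) \<subseteq> X0"
        by (auto simp: S_def)
    qed simp
    then have "card X0 = card (S (Suc 0))" by (rule bij_betw_same_card)
    then show ?case by simp
  next
    case (Suc n)
    let ?m = "Suc (Suc n)"
    define V where "V f = X - (\<Union>i\<in>{1..Suc n}. {y \<in> X. R (f i) y})" for f :: "nat \<Rightarrow> 'b"
    have fX: "f i \<in> X" if "f \<in> S (Suc n)" "i \<in> {1..Suc n}" for f i
      using that PiE_mem[of f "{1..Suc n}" "\<lambda>_. X" i] unfolding S_def by blast
    have finS: "finite (S (Suc n))"
      unfolding S_def by (rule finite_subset[of _ "{1..Suc n} \<rightarrow>\<^sub>E X"]) (auto intro!: finite_PiE fin)
    have image: "S ?m = (\<lambda>(f, x). f(?m := x)) ` (SIGMA f:S (Suc n). V f)"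
    proof (intro equalityI subsetI)
      fix g assume g: "g \<in> S ?m"
      define f where "f = g(?m := undefined)"
      have fS: "f \<in> S (Suc n)"
      proof -
        have gE: "g \<in> {1..?m} \<rightarrow>\<^sub>E X" using g unfolding S_def by blast
        have "f \<in> {1..Suc n} \<rightarrow>\<^sub>E X"
        proof (rule PiE_I)
          fix i assume "i \<in> {1..Suc n}"
          then show "f i \<in> X" using PiE_mem[OF gE, of i] by (simp add: f_def)
        next
          fix i assume i: "i \<notin> {1..Suc n}"
          show "f i = undefined"
          proof (cases "i = ?m")
            case False
            with i have "i \<notin> {1..?m}" by auto
            then show ?thesis using PiE_arb[OF gE, of i] False by (simp add: f_def)
          qed (simp add: f_def)
        qed
        moreover have "f 1 \<in> X0" using g by (simp add: S_def f_def)
        moreover have "\<forall>k\<in>{1..Suc n}. \<forall>i\<in>{1..<k}. \<not> R (f i) (f k)" using g by (simp add: S_def f_def)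
        ultimately show ?thesis unfolding S_def by blast
      qed
      have "g ?m \<in> V f"
      proof -
        have "g \<in> {1..?m} \<rightarrow>\<^sub>E X" using g unfolding S_def by blast
        then have "g ?m \<in> X" by (rule PiE_mem) simp
        moreover have "\<not> R (f i) (g ?m)" if "i \<in> {1..Suc n}" for i
          using g that by (simp add: S_def f_def)
        ultimately show ?thesis unfolding V_def by blast
      qed
      moreover have "g = f(?m := g ?m)" by (simp add: f_def)
      ultimately show "g \<in> (\<lambda>(f, x). f(?m := x)) ` (SIGMA f:S (Suc n). V f)"
        using fS by (intro image_eqI[of _ _ "(f, g ?m)"]) simp_all
    next
      fix g assume "g \<in> (\<lambda>(f, x). f(?m := x)) ` (SIGMA f:S (Suc n). V f)"
      then obtain f x where f: "f \<in> S (Suc n)" and x: "x \<in> V f" and g: "g = f(?m := x)" by auto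
      have "x \<in> X" using x by (simp add: V_def)
      moreover have "f \<in> {1..Suc n} \<rightarrow>\<^sub>E X" using f unfolding S_def by blast
      ultimately have "g \<in> insert ?m {1..Suc n} \<rightarrow>\<^sub>E X"
        unfolding g by (rule PiE_fun_upd)
      moreover have "insert ?m {1..Suc n} = {1..?m}" by auto
      ultimately have "g \<in> {1..?m} \<rightarrow>\<^sub>E X" by simp
      moreover have "g 1 \<in> X0" using f by (simp add: S_def g)
      moreover have "\<not> R (g i) (g k)" if ik: "k \<in> {1..?m}" "i \<in> {1..<k}" for i k
      proof (cases "k = ?m")
        case True
        then have "i \<in> {1..Suc n}" using ik by auto
        then show ?thesis using x \<open>x \<in> X\<close> True unfolding V_def g by auto
      next
        case False
        then have "k \<in> {1..Suc n}" "i \<noteq> ?m" using ik by auto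
        then show ?thesis using f ik False unfolding S_def g by simp
      qed
      ultimately show "g \<in> S ?m" unfolding S_def by blast
    qed
    have "inj_on (\<lambda>(f, x). f(?m := x)) (SIGMA f:S (Suc n). V f)"
    proof (rule inj_onI, clarify)
      fix f x g y
      assume f: "f \<in> S (Suc n)" and g: "g \<in> S (Suc n)" and eq: "f(?m := x) = g(?m := y)"
      have "f ?m = undefined" "g ?m = undefined"
        using f g unfolding S_def PiE_def extensional_def by simp_all
      then have "f = (f(?m := x))(?m := undefined)" "g = (g(?m := y))(?m := undefined)"
        by (metis fun_upd_triv fun_upd_upd)+
      then show "f = g \<and> x = y" using eq by (metis fun_upd_same)
    qed
    then have "card (S ?m) = card (SIGMA f:S (Suc n). V f)"
      unfolding image by (rule card_image)
    also have "\<dots> = (\<Sum>f\<in>S (Suc n). card (V f))"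
      using finS fin by (intro card_SigmaI) (auto simp: V_def)
    finally have card: "int (card (S ?m)) = (\<Sum>f\<in>S (Suc n). int (card (V f)))" by simp
    have "int (card (V f)) = int (card X) - int c * int (Suc n)" if f: "f \<in> S (Suc n)" for f
    proof -
      have disj: "{y \<in> X. R (f i) y} \<inter> {y \<in> X. R (f j) y} = {}"
        if ij: "i \<in> {1..Suc n}" "j \<in> {1..Suc n}" "i \<noteq> j" for i j
      proof (rule ccontr)
        assume "\<not> ?thesis"
        then obtain y where y: "y \<in> X" "R (f i) y" "R (f j) y" by blast
        have "R (f i) (f j)" "R (f j) (f i)"
          using R[OF fX[OF f ij(1)] fX[OF f ij(2)] y(1)] R[OF fX[OF f ij(2)] fX[OF f ij(1)] y(1)] y by blast+
        moreover have "i < j \<or> j < i" using ij(3) by linarith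
        ultimately show False using f ij(1,2) unfolding S_def by auto
      qed
      have "card (\<Union>i\<in>{1..Suc n}. {y \<in> X. R (f i) y}) = (\<Sum>i\<in>{1..Suc n}. card {y \<in> X. R (f i) y})"
        using fin disj by (intro card_UN_disjoint) auto
      also have "\<dots> = (\<Sum>i\<in>{1..Suc n}. c)" using fX[OF f] c by (intro sum.cong) auto
      finally have U: "card (\<Union>i\<in>{1..Suc n}. {y \<in> X. R (f i) y}) = c * Suc n" by simp
      have sub: "(\<Union>i\<in>{1..Suc n}. {y \<in> X. R (f i) y}) \<subseteq> X" by blast
      have "card (V f) = card X - c * Suc n"
        unfolding V_def by (subst card_Diff_subset) (use fin sub finite_subset U in auto)
      moreover have "c * Suc n \<le> card X" using card_mono[OF fin sub] U by simp
      ultimately show ?thesis by (simp only: of_nat_diff of_nat_mult)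
    qed
    then have "int (card (S ?m)) = int (card (S (Suc n))) * (int (card X) - int c * int (Suc n))"
      unfolding card by simp
    then show ?case unfolding Suc.IH by (simp add: algebra_simps)
  qed
  then show ?thesis unfolding S_def .
qed

lemma dvd_add_or_diff_trans:
  fixes m x y z :: int
  assumes "m dvd x - z \<or> m dvd x + z" "m dvd y - z \<or> m dvd y + z"
  shows "m dvd x - y \<or> m dvd x + y"
proof -
  consider "m dvd x - z" "m dvd y - z" | "m dvd x - z" "m dvd y + z"
    | "m dvd x + z" "m dvd y - z" | "m dvd x + z" "m dvd y + z" using assms by blast
  then show ?thesis
  proof cases
    case 1
    then show ?thesis using dvd_diff[of m "x - z" "y - z"] by simp
  next
    case 2
    then show ?thesis using dvd_add[of m "x - z" "y + z"] by simp
  next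
    case 3
    then show ?thesis using dvd_add[of m "x + z" "y - z"] by simp
  next
    case 4
    then show ?thesis using dvd_diff[of m "x + z" "y + z"] by simp
  qed
qed

lemma dvd_imp_eq_of_small:
  fixes m a :: int
  assumes "m dvd a" "\<bar>a\<bar> < m"
  shows "a = 0"
  using assms dvd_imp_le_int[of a m] by force

definition parity_residues :: "int \<Rightarrow> int \<Rightarrow> int set" where
  "parity_residues q r = {u \<in> {0..<2 * q}. u mod 2 = r}"

lemma finite_parity_residues: "finite (parity_residues q r)"
  by (rule finite_subset[of _ "{0..<2 * q}"]) (auto simp: parity_residues_def)

lemma card_parity_residues:
  assumes "r \<in> {0, 1}" "q \<ge> 0"
  shows "card (parity_residues q r) = nat q"
proof -
  have "bij_betw (\<lambda>k. 2 * k + r) {0..<q} (parity_residues q r)"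
  proof (rule bij_betw_byWitness[where f' = "\<lambda>u. u div 2"])
    show "\<forall>a\<in>{0..<q}. (2 * a + r) div 2 = a" using assms by auto
    show "\<forall>u\<in>parity_residues q r. 2 * (u div 2) + r = u"
      by (auto simp: parity_residues_def)
    show "(\<lambda>k. 2 * k + r) ` {0..<q} \<subseteq> parity_residues q r"
      using assms by (auto simp: parity_residues_def)
    show "(\<lambda>u. u div 2) ` parity_residues q r \<subseteq> {0..<q}"
      by (auto simp: parity_residues_def)
  qed
  then show ?thesis using bij_betw_same_card by fastforce
qed

text \<open>
  The values that a doubled coordinate of parity \<open>r\<close> can take modulo \<open>2 q\<close> at a point off the hyperplanes
  of the long roots.
\<close>

definition regular_residues :: "int \<Rightarrow> int \<Rightarrow> int set" where
  "regular_residues q r = {u \<in> parity_residues q r. \<not> q dvd u}"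

lemma regular_residues_eq:
  assumes "q > 0"
  shows "regular_residues q r = parity_residues q r - {0, q}"
proof (intro equalityI subsetI)
  fix u assume "u \<in> regular_residues q r"
  then show "u \<in> parity_residues q r - {0, q}" by (auto simp: regular_residues_def)
next
  fix u assume u: "u \<in> parity_residues q r - {0, q}"
  have "\<not> q dvd u"
  proof
    assume "q dvd u"
    then have "q dvd u - q" by simp
    moreover have "\<bar>u - q\<bar> < q" using u by (auto simp: parity_residues_def)
    ultimately have "u - q = 0" by (rule dvd_imp_eq_of_small)
    then show False using u by simp
  qed
  then show "u \<in> regular_residues q r" using u by (simp add: regular_residues_def)
qed

lemma card_regular_residues:
  assumes "q > 0" "r \<in> {0, 1}"
  shows "int (card (regular_residues q r)) = (if odd q then q - 1 else if r = 0 then q - 2 else q)"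
proof -
  have mem: "0 \<in> parity_residues q r \<longleftrightarrow> r = 0" "q \<in> parity_residues q r \<longleftrightarrow> q mod 2 = r"
    using assms by (auto simp: parity_residues_def)
  have "parity_residues q r \<inter> {0, q} =
      (if odd q then (if r = 0 then {0} else {q}) else if r = 0 then {0, q} else {})"
    using mem assms by (auto simp: odd_iff_mod_2_eq_one)
  then have "card (parity_residues q r \<inter> {0, q}) = (if odd q then 1 else if r = 0 then 2 else 0)"
    using assms by auto
  moreover have "card (parity_residues q r \<inter> {0, q}) \<le> card (parity_residues q r)"
    by (rule card_mono[OF finite_parity_residues]) blast
  moreover have "card (regular_residues q r) = card (parity_residues q r) - card (parity_residues q r \<inter> {0, q})"
    unfolding regular_residues_eq[OF assms(1)] by (rule card_Diff_subset_Int) simp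
  ultimately show ?thesis
    using assms card_parity_residues[of r q] by (auto split: if_splits)
qed

lemma regular_residues_flip:
  assumes "u \<in> regular_residues q r" "q > 0"
  shows "2 * q - u \<in> regular_residues q r"
proof -
  have "u \<noteq> 0" using assms by (auto simp: regular_residues_def)
  moreover have "(2 * q - u) mod 2 = u mod 2" by presburger
  moreover have "q dvd 2 * q - u \<longleftrightarrow> q dvd u" by (simp add: dvd_diff_right_iff)
  ultimately show ?thesis using assms by (simp add: regular_residues_def parity_residues_def)
qed

lemma card_regular_residues_half:
  assumes "q > 0"
  shows "2 * card {u \<in> regular_residues q r. u < q} = card (regular_residues q r)"
proof -
  let ?X = "regular_residues q r"
  have fin: "finite ?X" using finite_parity_residues by (simp add: regular_residues_def)
  have ne: "u \<noteq> q" if "u \<in> ?X" for u using that by (auto simp: regular_residues_def)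
  have "bij_betw (\<lambda>u. 2 * q - u) {u \<in> ?X. u < q} {u \<in> ?X. \<not> u < q}"
  proof (rule bij_betw_byWitness[where f' = "\<lambda>u. 2 * q - u"])
    show "(\<lambda>u. 2 * q - u) ` {u \<in> ?X. u < q} \<subseteq> {u \<in> ?X. \<not> u < q}"
      using regular_residues_flip[OF _ assms] by auto
    show "(\<lambda>u. 2 * q - u) ` {u \<in> ?X. \<not> u < q} \<subseteq> {u \<in> ?X. u < q}"
      using regular_residues_flip[OF _ assms] ne by (auto simp: less_le)
  qed simp_all
  then have "card {u \<in> ?X. u < q} = card {u \<in> ?X. \<not> u < q}" by (rule bij_betw_same_card)
  moreover have "card ?X = card {u \<in> ?X. u < q} + card {u \<in> ?X. \<not> u < q}"
    by (subst card_Un_disjoint[symmetric]) (use fin in \<open>auto intro: arg_cong[where f = card]\<close>)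
  ultimately show ?thesis by simp
qed

lemma card_class_regular:
  assumes u: "u \<in> regular_residues q r" and q: "q > 0"
  shows "card {v \<in> regular_residues q r. 2 * q dvd u - v \<or> 2 * q dvd u + v} = 2"
proof -
  have bnd: "0 \<le> v" "v < 2 * q" "\<not> q dvd v" if "v \<in> regular_residues q r" for v
    using that by (auto simp: regular_residues_def parity_residues_def)
  have "{v \<in> regular_residues q r. 2 * q dvd u - v \<or> 2 * q dvd u + v} = {u, 2 * q - u}"
  proof (intro equalityI subsetI)
    fix v assume "v \<in> {v \<in> regular_residues q r. 2 * q dvd u - v \<or> 2 * q dvd u + v}"
    then have v: "v \<in> regular_residues q r" and "2 * q dvd u - v \<or> 2 * q dvd u + v" by auto
    then consider "2 * q dvd u - v" | "2 * q dvd u + v" by blast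
    then show "v \<in> {u, 2 * q - u}"
    proof cases
      case 1
      then have "u - v = 0" using bnd[OF u] bnd[OF v] by (intro dvd_imp_eq_of_small[of "2 * q"]) auto
      then show ?thesis by simp
    next
      case 2
      then have "2 * q dvd u + v - 2 * q" by simp
      moreover have "\<bar>u + v - 2 * q\<bar> < 2 * q"
      proof -
        have "u \<noteq> 0" using bnd(3)[OF u] by auto
        then show ?thesis using bnd(1,2)[OF u] bnd(1,2)[OF v] by linarith
      qed
      ultimately have "u + v - 2 * q = 0" by (rule dvd_imp_eq_of_small)
      then show ?thesis by simp
    qed
  next
    fix v assume "v \<in> {u, 2 * q - u}"
    then show "v \<in> {v \<in> regular_residues q r. 2 * q dvd u - v \<or> 2 * q dvd u + v}"
      using u regular_residues_flip[OF u q] by auto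
  qed
  moreover have "u \<noteq> 2 * q - u" using bnd(3)[OF u] by auto
  ultimately show ?thesis by simp
qed

text \<open>
  The values modulo \<open>2 q = 4 h\<close> that a doubled coordinate other than the middle one can take at a point
  fixed by \<open>\<omega>\<close>: the parity is that of the middle coordinate \<open>h\<close>, and the multiples of \<open>h\<close> either
  agree with it up to sign or lie on the hyperplane of a long root.
\<close>

definition quarter_free_residues :: "int \<Rightarrow> int set" where
  "quarter_free_residues h = {u \<in> parity_residues (2 * h) (h mod 2). \<not> h dvd u}"

lemma quarter_free_residues_eq:
  assumes h: "h > 0"
  shows "quarter_free_residues h = parity_residues (2 * h) (h mod 2) - {0, h, 2 * h, 3 * h}"
proof (intro equalityI subsetI)
  fix u assume "u \<in> quarter_free_residues h"
  then show "u \<in> parity_residues (2 * h) (h mod 2) - {0, h, 2 * h, 3 * h}"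
    by (auto simp: quarter_free_residues_def)
next
  fix u assume u: "u \<in> parity_residues (2 * h) (h mod 2) - {0, h, 2 * h, 3 * h}"
  have "\<not> h dvd u"
  proof
    assume "h dvd u"
    then obtain k where k: "u = h * k" by (rule dvdE)
    have "0 \<le> u" "u < 4 * h" using u by (auto simp: parity_residues_def)
    then have "h * (- 1) < h * k" "h * k < h * 4" using h unfolding k by linarith+
    then have "- 1 < k" "k < 4" using h by (simp_all only: mult_less_cancel_left_pos)
    then have "k = 0 \<or> k = 1 \<or> k = 2 \<or> k = 3" by linarith
    then show False using u k by auto
  qed
  then show "u \<in> quarter_free_residues h" using u by (simp add: quarter_free_residues_def)
qed

lemma card_quarter_free_residues:
  assumes h: "h > 0"
  shows "int (card (quarter_free_residues h)) = (if odd h then 2 * h - 2 else 2 * h - 4)"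
proof -
  let ?A = "parity_residues (2 * h) (h mod 2)"
  have r: "h mod 2 \<in> {0, 1}" by auto
  have mem: "0 \<in> ?A \<longleftrightarrow> even h" "h \<in> ?A" "2 * h \<in> ?A \<longleftrightarrow> even h" "3 * h \<in> ?A"
    using h by (auto simp: parity_residues_def) presburger+
  have "?A \<inter> {0, h, 2 * h, 3 * h} = (if odd h then {h, 3 * h} else {0, h, 2 * h, 3 * h})"
    using mem by auto
  then have "card (?A \<inter> {0, h, 2 * h, 3 * h}) = (if odd h then 2 else 4)"
    using h by auto
  moreover have "card (?A \<inter> {0, h, 2 * h, 3 * h}) \<le> card ?A"
    by (rule card_mono[OF finite_parity_residues]) blast
  moreover have "card (quarter_free_residues h) = card ?A - card (?A \<inter> {0, h, 2 * h, 3 * h})"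
    unfolding quarter_free_residues_eq[OF h] by (rule card_Diff_subset_Int) simp
  ultimately show ?thesis
    using h card_parity_residues[OF r, of "2 * h"] by (auto split: if_splits)
qed

text \<open>
  Modulo \<open>2 h\<close> the class consists of \<open>u\<close> and \<open>- u\<close>, which differ because \<open>h\<close> does not divide \<open>u\<close>. Each of
  them has two representatives below \<open>4 h\<close>.
\<close>

lemma card_class_quarter_free:
  assumes u: "u \<in> quarter_free_residues h" and h: "h > 0"
  shows "card {v \<in> quarter_free_residues h. 2 * h dvd u - v \<or> 2 * h dvd u + v} = 4"
proof -
  let ?X = "quarter_free_residues h"
  define r where "r = u mod (2 * h)"
  have r: "0 \<le> r" "r < 2 * h" "2 * h dvd u - r"
    using h by (simp_all add: r_def minus_mod_eq_mult_div)
  have mod2: "even v \<longleftrightarrow> even v'" if "2 * h dvd v - v'" for v v'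
  proof -
    have "2 dvd v - v'" using that by (rule dvd_mult_left)
    then show ?thesis by presburger
  qed
  have "\<not> h dvd u" and "u mod 2 = h mod 2"
    using u by (auto simp: quarter_free_residues_def parity_residues_def)
  have "h dvd u - r" using r(3) by (rule dvd_mult_right)
  then have "\<not> h dvd r" using \<open>\<not> h dvd u\<close> dvd_add[of h "u - r" r] by auto
  moreover have "even r \<longleftrightarrow> even h"
    using mod2[OF r(3)] \<open>u mod 2 = h mod 2\<close> by presburger
  ultimately have hr: "\<not> h dvd r" "even r \<longleftrightarrow> even h" by blast+
  have X_iff: "v \<in> ?X \<longleftrightarrow> 0 \<le> v \<and> v < 4 * h \<and> (even v \<longleftrightarrow> even h) \<and> \<not> h dvd v" for v
  proof -
    have "v mod 2 = h mod 2 \<longleftrightarrow> (even v \<longleftrightarrow> even h)" by presburger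
    then show ?thesis unfolding quarter_free_residues_def parity_residues_def by auto
  qed
  have rel: "2 * h dvd u - v \<or> 2 * h dvd u + v \<longleftrightarrow> 2 * h dvd r - v \<or> 2 * h dvd r + v" for v
  proof -
    have "2 * h dvd (u - r) + (r - v) \<longleftrightarrow> 2 * h dvd r - v" "2 * h dvd (u - r) + (r + v) \<longleftrightarrow> 2 * h dvd r + v"
      by (rule dvd_add_right_iff[OF r(3)])+
    then show ?thesis by simp
  qed
  have ne: "r \<noteq> 0" "r \<noteq> h" using hr by auto
  have "{v \<in> ?X. 2 * h dvd u - v \<or> 2 * h dvd u + v} = {r, r + 2 * h, 2 * h - r, 4 * h - r}"
    unfolding rel
  proof (intro equalityI subsetI)
    fix v assume v: "v \<in> {v \<in> ?X. 2 * h dvd r - v \<or> 2 * h dvd r + v}"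
    then have bnd: "0 \<le> v" "v < 4 * h" by (auto simp: X_iff)
    from v consider "2 * h dvd v - r" | "2 * h dvd v + r" by (auto simp: dvd_diff_commute add.commute)
    then show "v \<in> {r, r + 2 * h, 2 * h - r, 4 * h - r}"
    proof cases
      case 1
      then obtain k where k: "v - r = 2 * h * k" by (rule dvdE)
      have "2 * h * (- 1) < 2 * h * k" "2 * h * k < 2 * h * 2" using k bnd r(1,2) by linarith+
      then have "- 1 < k" "k < 2" using h by (simp_all only: mult_less_cancel_left_pos)
      then have "k = 0 \<or> k = 1" by linarith
      then show ?thesis using k by auto
    next
      case 2
      then obtain k where k: "v + r = 2 * h * k" by (rule dvdE)
      have "2 * h * 0 < 2 * h * k" "2 * h * k < 2 * h * 3" using k bnd r(1,2) ne(1) by linarith+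
      then have "0 < k" "k < 3" using h by (simp_all only: mult_less_cancel_left_pos)
      then have "k = 1 \<or> k = 2" by linarith
      then show ?thesis using k by auto
    qed
  next
    fix v assume v: "v \<in> {r, r + 2 * h, 2 * h - r, 4 * h - r}"
    have "h dvd r + 2 * h \<longleftrightarrow> h dvd r" "h dvd 2 * h - r \<longleftrightarrow> h dvd r" "h dvd 4 * h - r \<longleftrightarrow> h dvd r"
      by (simp_all add: dvd_diff_right_iff)
    moreover have "2 * h dvd 4 * h" by (rule dvdI[of _ _ 2]) simp
    ultimately show "v \<in> {v \<in> ?X. 2 * h dvd r - v \<or> 2 * h dvd r + v}"
      using v r(1,2) h ne hr by (auto simp: X_iff)
  qed
  moreover have "card {r, r + 2 * h, 2 * h - r, 4 * h - r} = 4"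
    using r(1,2) ne h by auto
  ultimately show ?thesis by simp
qed

section \<open>Normal forms\<close>

text \<open>
  The doubled coordinates of the points of the toric complement; see \<open>toric_iff_regular\<close>. The case
  \<open>i = k\<close> of the second condition belongs to the long roots.
\<close>

definition regular :: "nat \<Rightarrow> int \<Rightarrow> (nat \<Rightarrow> int) \<Rightarrow> bool" where
  "regular l q u \<longleftrightarrow>
     (\<forall>i\<in>{1..l}. \<forall>k\<in>{1..l}. even (u i - u k) \<and> \<not> 2 * q dvd u i + u k \<and>
        (i \<noteq> k \<longrightarrow> \<not> 2 * q dvd u i - u k))"

text \<open>
  Translations by \<open>q\<close> times a lattice vector change doubled coordinates by multiples of \<open>2 q\<close>, or all
  of them by odd multiples of \<open>q\<close>. The bound on \<open>f p\<close> selects one of the two resulting tuples modulo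
  \<open>2 q\<close>.
\<close>

definition normal_forms :: "nat \<Rightarrow> int \<Rightarrow> nat \<Rightarrow> (nat \<Rightarrow> int) set" where
  "normal_forms l q p = {f \<in> {1..l} \<rightarrow>\<^sub>E {0..<2 * q}. regular l q f \<and> f p < q}"

lemma regularD:
  assumes "regular l q u" "i \<in> {1..l}" "k \<in> {1..l}"
  shows "even (u i - u k)" "\<not> 2 * q dvd u i + u k" "i \<noteq> k \<Longrightarrow> \<not> 2 * q dvd u i - u k"
  using assms unfolding regular_def by blast+

lemma regularI:
  assumes "\<And>i k. i \<in> {1..l} \<Longrightarrow> k \<in> {1..l} \<Longrightarrow> even (u i - u k)"
    and "\<And>i k. i \<in> {1..l} \<Longrightarrow> k \<in> {1..l} \<Longrightarrow> \<not> 2 * q dvd u i + u k"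
    and "\<And>i k. i \<in> {1..l} \<Longrightarrow> k \<in> {1..l} \<Longrightarrow> i \<noteq> k \<Longrightarrow> \<not> 2 * q dvd u i - u k"
  shows "regular l q u"
  using assms unfolding regular_def by blast

lemma normal_formsD:
  assumes "f \<in> normal_forms l q p"
  shows "f \<in> {1..l} \<rightarrow>\<^sub>E {0..<2 * q}" "regular l q f" "f p < q"
    "i \<in> {1..l} \<Longrightarrow> 0 \<le> f i" "i \<in> {1..l} \<Longrightarrow> f i < 2 * q"
proof -
  show f: "f \<in> {1..l} \<rightarrow>\<^sub>E {0..<2 * q}" "regular l q f" "f p < q"
    using assms unfolding normal_forms_def by blast+
  { assume "i \<in> {1..l}"
    then have "f i \<in> {0..<2 * q}" using PiE_mem[OF f(1)] by blast
    then show "0 \<le> f i" "f i < 2 * q" by simp_all }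
qed

lemma finite_normal_forms: "finite (normal_forms l q p)"
  by (rule finite_subset[of _ "{1..l} \<rightarrow>\<^sub>E {0..<2 * q}"])
    (auto simp: normal_forms_def intro!: finite_PiE)

text \<open>
  The two summands are the two parities. By the symmetry \<open>u \<mapsto> 2 q - u\<close>, half of the possible values of
  the first coordinate satisfy the normalization, which accounts for the factor 2 on the left.
\<close>

lemma card_normal_forms:
  assumes q: "q > 0" and l: "l > 0"
  shows "2 * int (card (normal_forms l q 1)) = (\<Sum>r\<in>{0, 1}. 
    int (card (regular_residues q r)) * (\<Prod>i=1..l-1. int (card (regular_residues q r)) - 2 * int i))"
proof -
  obtain n where n: "l = Suc n" using l by (cases l) auto
  let ?X = "regular_residues q"
  let ?R = "\<lambda>u v. 2 * q dvd u - v \<or> 2 * q dvd u + v"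
  define E where "E r = {f \<in> {1..l} \<rightarrow>\<^sub>E ?X r. f 1 \<in> {u \<in> ?X r. u < q} \<and>
    (\<forall>k\<in>{1..l}. \<forall>i\<in>{1..<k}. \<not> ?R (f i) (f k))}" for r
  have one: "1 \<in> {1..l}" using l by simp
  have X_iff: "v \<in> ?X r \<longleftrightarrow> 0 \<le> v \<and> v < 2 * q \<and> v mod 2 = r \<and> \<not> q dvd v" for v r
    by (auto simp: regular_residues_def parity_residues_def)
  have E_X: "f i \<in> ?X r" if "f \<in> E r" "i \<in> {1..l}" for f r i
    using that PiE_mem[of f "{1..l}" "\<lambda>_. ?X r" i] unfolding E_def by blast
  have double: "2 * q dvd v + v \<longleftrightarrow> q dvd v" for v :: int
    by (simp flip: mult_2)
  have eq: "normal_forms l q 1 = E 0 \<union> E 1"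
  proof (intro equalityI subsetI)
    fix f assume f: "f \<in> normal_forms l q 1"
    note reg = regularD[OF normal_formsD(2)[OF f]]
    define r where "r = f 1 mod 2"
    have X: "f i \<in> ?X r" if i: "i \<in> {1..l}" for i
    proof -
      have "f i mod 2 = r" using reg(1)[OF i one] unfolding r_def by presburger
      moreover have "\<not> q dvd f i" using reg(2)[OF i i] unfolding double .
      ultimately show ?thesis using normal_formsD(4,5)[OF f i] unfolding X_iff by blast
    qed
    have "f \<in> {1..l} \<rightarrow>\<^sub>E ?X r"
    proof (rule PiE_I)
      fix i assume "i \<notin> {1..l}"
      then show "f i = undefined" by (rule PiE_arb[OF normal_formsD(1)[OF f]])
    qed (rule X)
    moreover have "\<not> ?R (f i) (f k)" if "k \<in> {1..l}" "i \<in> {1..<k}" for i k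
      using reg(2,3)[of i k] that by auto
    ultimately have "f \<in> E r"
      using X[OF one] normal_formsD(3)[OF f] unfolding E_def by blast
    moreover have "r = 0 \<or> r = 1" unfolding r_def by auto
    ultimately show "f \<in> E 0 \<union> E 1" by blast
  next
    fix f assume "f \<in> E 0 \<union> E 1"
    then obtain r where f: "f \<in> E r" by blast
    have R: "\<not> ?R (f i) (f k)" if "i \<in> {1..l}" "k \<in> {1..l}" "i \<noteq> k" for i k
    proof (cases "i < k")
      case True
      then show ?thesis using f that unfolding E_def by auto
    next
      case False
      then have "k < i" using that(3) by simp
      then have "\<not> ?R (f k) (f i)" using f that unfolding E_def by auto
      then show ?thesis by (simp add: dvd_diff_commute add.commute)
    qed
    have "regular l q f"
    proof (rule regularI)
      fix i k assume ik: "i \<in> {1..l}" "k \<in> {1..l}"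
      note X = E_X[OF f ik(1), unfolded X_iff] E_X[OF f ik(2), unfolded X_iff]
      have "f i mod 2 = r" "f k mod 2 = r" using X by blast+
      then show "even (f i - f k)" by presburger
      show "\<not> 2 * q dvd f i + f k"
      proof (cases "i = k")
        case True
        then show ?thesis using X double by simp
      next
        case False
        then show ?thesis using R[OF ik] by blast
      qed
      show "\<not> 2 * q dvd f i - f k" if "i \<noteq> k" using R[OF ik that] by blast
    qed
    moreover have "f \<in> {1..l} \<rightarrow>\<^sub>E {0..<2 * q}"
    proof (rule PiE_I)
      fix i assume "i \<in> {1..l}"
      from E_X[OF f this] show "f i \<in> {0..<2 * q}" unfolding X_iff by simp
    next
      fix i assume "i \<notin> {1..l}"
      moreover have "f \<in> {1..l} \<rightarrow>\<^sub>E ?X r" using f unfolding E_def by blast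
      ultimately show "f i = undefined" by (rule PiE_arb[rotated])
    qed
    moreover have "f 1 < q" using f unfolding E_def by blast
    ultimately show "f \<in> normal_forms l q 1" unfolding normal_forms_def by blast
  qed
  have fin: "finite (E 0)" "finite (E 1)"
    using finite_normal_forms[of l q 1] unfolding eq by simp_all
  have disj: "E 0 \<inter> E 1 = {}"
  proof -
    have False if "f \<in> E 0" "f \<in> E 1" for f
      using E_X[OF that(1) one] E_X[OF that(2) one] unfolding X_iff by simp
    then show ?thesis by blast
  qed
  have cardE: "2 * int (card (E r)) =
      int (card (?X r)) * (\<Prod>i=1..l-1. int (card (?X r)) - 2 * int i)" for r
  proof -
    have finX: "finite (?X r)" unfolding regular_residues_def using finite_parity_residues by simp
    have "int (card (E r)) = int (card {u \<in> ?X r. u < q}) * (\<Prod>i=1..n. int (card (?X r)) - int 2 * int i)"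
      unfolding E_def n
    proof (rule card_inequivalent_sequences[OF finX])
      show "\<And>x y z. ?R x z \<Longrightarrow> ?R y z \<Longrightarrow> ?R x y" by (rule dvd_add_or_diff_trans)
      show "\<And>x. x \<in> ?X r \<Longrightarrow> card {y \<in> ?X r. ?R x y} = 2" by (rule card_class_regular[OF _ q])
    qed blast
    moreover have "2 * int (card {u \<in> ?X r. u < q}) = int (card (?X r))"
      using card_regular_residues_half[OF q, of r] by linarith
    ultimately show ?thesis by (simp add: n flip: mult.assoc)
  qed
  have "2 * int (card (normal_forms l q 1)) = 2 * int (card (E 0)) + 2 * int (card (E 1))"
    unfolding eq card_Un_disjoint[OF fin disj] by simp
  then show ?thesis unfolding cardE by simp
qed

lemma card_normal_forms_odd:
  assumes q: "q > 0" "odd q" and l: "l > 0"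
  shows "int (card (normal_forms l q 1)) = (\<Prod>i=1..l. q - (2 * int i - 1))"
proof -
  obtain n where n: "l = Suc n" using l by (cases l) auto
  have X: "int (card (regular_residues q 0)) = q - 1" "int (card (regular_residues q 1)) = q - 1"
    using card_regular_residues[OF q(1), of 0] card_regular_residues[OF q(1), of 1] q(2) by simp_all
  have "2 * int (card (normal_forms l q 1)) = 2 * ((q - 1) * (\<Prod>i=1..n. (q - 1) - 2 * int i))"
    using card_normal_forms[OF q(1) l] unfolding n by (simp add: X)
  also have "(\<Prod>i=1..n. (q - 1) - 2 * int i) = (\<Prod>i=Suc 1..Suc n. q - (2 * int i - 1))"
    unfolding prod.shift_bounds_cl_Suc_ivl by (rule prod.cong) simp_all
  also have "(q - 1) * \<dots> = (\<Prod>i=1..Suc n. q - (2 * int i - 1))"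
    using prod.atLeast_Suc_atMost[of 1 "Suc n" "\<lambda>i. q - (2 * int i - 1)"] by simp
  finally show ?thesis unfolding n by simp
qed

lemma card_normal_forms_even:
  assumes q: "q > 0" "even q" and l: "l > 0"
  shows "int (card (normal_forms l q 1)) = (\<Prod>i=1..l-1. q - 2 * int i) * (q - int l)"
proof -
  obtain n where n: "l = Suc n" using l by (cases l) auto
  have X: "int (card (regular_residues q 0)) = q - 2" "int (card (regular_residues q 1)) = q"
    using card_regular_residues[OF q(1), of 0] card_regular_residues[OF q(1), of 1] q(2) by simp_all
  let ?P = "\<Prod>i=1..n. q - 2 * int i"
  have "(\<Prod>i=1..n. (q - 2) - 2 * int i) = (\<Prod>i=Suc 1..Suc n. q - 2 * int i)"
    unfolding prod.shift_bounds_cl_Suc_ivl by (rule prod.cong) simp_all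
  then have "(q - 2) * (\<Prod>i=1..n. (q - 2) - 2 * int i) = (\<Prod>i=1..Suc n. q - 2 * int i)"
    using prod.atLeast_Suc_atMost[of 1 "Suc n" "\<lambda>i. q - 2 * int i"] by simp
  also have "\<dots> = ?P * (q - 2 * int (Suc n))" by (simp add: prod.nat_ivl_Suc')
  finally have "2 * int (card (normal_forms l q 1)) = ?P * (q - 2 * int (Suc n)) + q * ?P"
    using card_normal_forms[OF q(1) l] unfolding n by (simp add: X)
  also have "\<dots> = 2 * (?P * (q - int (Suc n)))" by (simp add: algebra_simps)
  finally show ?thesis unfolding n by simp
qed

text \<open>
  The normal forms of the points fixed by \<open>\<omega>\<close>. They are normalized at the middle index \<open>n + 1\<close>, because
  the symmetry determines that coordinate completely.
\<close>

definition symmetric_forms :: "nat \<Rightarrow> int \<Rightarrow> (nat \<Rightarrow> int) set" where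
  "symmetric_forms n q = {f \<in> normal_forms (2 * n + 1) q (n + 1).
     \<forall>i\<in>{1..2 * n + 1}. 2 * q dvd f i + f (2 * n + 2 - i) + q}"

text \<open>
  At the middle index the symmetry condition says that an even number plus \<open>q\<close> is divisible by 2.
\<close>

lemma symmetric_forms_odd:
  assumes "odd q"
  shows "symmetric_forms n q = {}"
proof -
  have False if "f \<in> symmetric_forms n q" for f
  proof -
    have "2 * q dvd f (n + 1) + f (2 * n + 2 - (n + 1)) + q"
      using that unfolding symmetric_forms_def by (auto dest!: bspec[of _ _ "n + 1"])
    then have "2 dvd f (n + 1) + f (2 * n + 2 - (n + 1)) + q" by (rule dvd_mult_left)
    moreover have "2 * n + 2 - (n + 1) = n + 1" by simp
    ultimately show False using assms by simp
  qed
  then show ?thesis by blast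
qed

lemma quarter_free_iff:
  "v \<in> quarter_free_residues h \<longleftrightarrow> 0 \<le> v \<and> v < 4 * h \<and> v mod 2 = h mod 2 \<and> \<not> h dvd v"
  unfolding quarter_free_residues_def parity_residues_def by auto

text \<open>
  The symmetry \<open>f i + f (2 n + 2 - i) \<equiv> 2 h\<close> modulo \<open>4 h\<close> recovers the upper half of \<open>f\<close> from the lower
  half, and the middle coordinate is \<open>h\<close>. Modulo \<open>2 h\<close> mirrored coordinates are negatives of each other.
  This is why the conditions modulo \<open>4 h\<close> on all pairs of coordinates amount to conditions modulo
  \<open>2 h\<close> on the lower half.
\<close>

lemma bij_betw_symmetric_forms:
  fixes h :: int
  assumes h: "h > 0"
  defines "R \<equiv> \<lambda>u v. 2 * h dvd u - v \<or> 2 * h dvd u + v"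
  shows "bij_betw (\<lambda>f. restrict f {1..n}) (symmetric_forms n (2 * h))
    {g \<in> {1..n} \<rightarrow>\<^sub>E quarter_free_residues h. \<forall>k\<in>{1..n}. \<forall>i\<in>{1..<k}. \<not> R (g i) (g k)}"
    (is "bij_betw _ ?F ?G")
proof -
  let ?I = "{1..2 * n + 1}" and ?X = "quarter_free_residues h"
  define ext where "ext g = (\<lambda>i\<in>?I. if i \<le> n then g i else if i = n + 1 then h
      else (2 * h - g (2 * n + 2 - i)) mod (4 * h))" for g :: "nat \<Rightarrow> int"
  have four: "2 * (2 * h) = 4 * h" by simp
  have mirror: "2 * n + 2 - i \<in> ?I" if "i \<in> ?I" for i using that by auto
  have symD: "f \<in> normal_forms (2 * n + 1) (2 * h) (n + 1)"
      "i \<in> ?I \<Longrightarrow> 4 * h dvd f i + f (2 * n + 2 - i) + 2 * h" if "f \<in> ?F" for f i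
    using that unfolding symmetric_forms_def four by blast+
  have middle: "f (n + 1) = h" if f: "f \<in> ?F" for f
  proof -
    have m: "n + 1 \<in> ?I" "2 * n + 2 - (n + 1) = n + 1" by simp_all
    have "4 * h dvd f (n + 1) + f (n + 1) + 2 * h" using symD(2)[OF f m(1)] unfolding m(2) .
    then have "2 * (2 * h) dvd 2 * (f (n + 1) + h)" by (simp add: algebra_simps)
    then have "2 * h dvd f (n + 1) + h" by (simp only: dvd_mult_cancel_left) simp
    then have "2 * h dvd f (n + 1) + h - 2 * h" by (rule dvd_diff) simp
    moreover have "\<bar>f (n + 1) + h - 2 * h\<bar> < 2 * h"
      using normal_formsD(3,4)[OF symD(1)[OF f]] m(1) h by fastforce
    ultimately have "f (n + 1) + h - 2 * h = 0" by (rule dvd_imp_eq_of_small)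
    then show ?thesis by simp
  qed
  \<comment> \<open>A multiple of \<open>2 h\<close> that is not one of \<open>4 h\<close> is \<open>2 h\<close> modulo \<open>4 h\<close>; the symmetry then turns
    a coincidence with \<open>f k\<close> modulo \<open>2 h\<close> into one with its mirror image modulo \<open>4 h\<close>.\<close>
  have odd_multiple: "4 * h dvd a - 2 * h" if "2 * h dvd a" "\<not> 4 * h dvd a" for a
  proof -
    obtain j where j: "a = 2 * h * j" using \<open>2 * h dvd a\<close> by (rule dvdE)
    have "odd j"
    proof
      assume "even j"
      then obtain j' where "j = 2 * j'" by (rule evenE)
      then have "a = 4 * h * j'" using j by simp
      then show False using \<open>\<not> 4 * h dvd a\<close> by simp
    qed
    then obtain j' where "j = 2 * j' + 1" by (rule oddE)
    then have "a - 2 * h = 4 * h * j'" using j by (simp add: algebra_simps)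
    then show ?thesis by simp
  qed
  show ?thesis
  proof (rule bij_betw_byWitness[where f' = ext])
    show "\<forall>f\<in>?F. ext (restrict f {1..n}) = f"
    proof
      fix f assume f: "f \<in> ?F"
      show "ext (restrict f {1..n}) = f"
      proof
        fix i
        consider "i \<notin> ?I" | "i \<in> ?I" "i \<le> n" | "i = n + 1" | "i \<in> ?I" "n + 1 < i" by force
        then show "ext (restrict f {1..n}) i = f i"
        proof cases
          case 1
          have "f i = undefined" by (rule PiE_arb[OF normal_formsD(1)[OF symD(1)[OF f]] 1])
          then show ?thesis using 1 by (simp only: ext_def restrict_apply if_False)
        next
          case 2
          then show ?thesis by (simp add: ext_def)
        next
          case 3
          then show ?thesis using middle[OF f] by (simp add: ext_def)
        next
          case 4
          have "4 * h dvd f i + f (2 * n + 2 - i) + 2 * h - 4 * h"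
            using symD(2)[OF f 4(1)] by (rule dvd_diff) simp
          also have "f i + f (2 * n + 2 - i) + 2 * h - 4 * h = f i - (2 * h - f (2 * n + 2 - i))" by simp
          finally have "f i mod (4 * h) = (2 * h - f (2 * n + 2 - i)) mod (4 * h)"
            by (simp only: mod_eq_dvd_iff)
          moreover have "f i mod (4 * h) = f i"
            using normal_formsD(4,5)[OF symD(1)[OF f] 4(1)] by simp
          moreover have "2 * n + 2 - i \<in> {1..n}" using 4 by auto
          ultimately show ?thesis using 4 by (simp add: ext_def)
        qed
      qed
    qed
    show "\<forall>g\<in>?G. restrict (ext g) {1..n} = g"
    proof
      fix g assume "g \<in> ?G"
      then have g: "g \<in> {1..n} \<rightarrow>\<^sub>E ?X" by blast
      show "restrict (ext g) {1..n} = g"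
      proof
        fix i show "restrict (ext g) {1..n} i = g i"
          using PiE_arb[OF g, of i] by (cases "i \<in> {1..n}") (auto simp: ext_def)
      qed
    qed
    show "(\<lambda>f. restrict f {1..n}) ` ?F \<subseteq> ?G"
    proof
      fix g assume "g \<in> (\<lambda>f. restrict f {1..n}) ` ?F"
      then obtain f where f: "f \<in> ?F" and g: "g = restrict f {1..n}" by blast
      note nf = symD(1)[OF f] 
      note reg = regularD[OF normal_formsD(2)[OF nf], unfolded four]
      have m: "n + 1 \<in> ?I" by simp
      have X: "f i \<in> ?X" if i: "i \<in> {1..n}" for i
      proof -
        have iI: "i \<in> ?I" and im: "i \<noteq> n + 1" using i by auto
        \<comment> \<open>An even multiple of \<open>h\<close> is excluded by the long root; an odd one is \<open>\<plusminus> h\<close> modulo \<open>4 h\<close>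
          and collides with the middle coordinate.\<close>
        have "\<not> h dvd f i"
        proof
          assume "h dvd f i"
          then have "2 * h dvd f i + f i" by (simp flip: mult_2)
          moreover have "\<not> 4 * h dvd f i + f i" by (rule reg(2)[OF iI iI])
          ultimately have "4 * h dvd f i + f i - 2 * h" by (rule odd_multiple)
          then have "2 * (2 * h) dvd 2 * (f i - h)" by (simp add: algebra_simps)
          then have d: "2 * h dvd f i - h" by (simp only: dvd_mult_cancel_left) simp
          moreover have "\<not> 4 * h dvd f i - h" using reg(3)[OF iI m im] unfolding middle[OF f] .
          ultimately have "4 * h dvd f i - h - 2 * h" by (rule odd_multiple)
          then have "4 * h dvd f i - h - 2 * h + 4 * h" by (rule dvd_add) simp
          then have "4 * h dvd f i + h" by (simp add: add.commute)
          then show False using reg(2)[OF iI m] unfolding middle[OF f] by blast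
        qed
        moreover have "f i mod 2 = h mod 2" using reg(1)[OF iI m] unfolding middle[OF f] by presburger
        ultimately show ?thesis
          using normal_formsD(4,5)[OF nf iI] unfolding quarter_free_iff four by blast
      qed
      have "\<not> R (f i) (f k)" if k: "k \<in> {1..n}" and i: "i \<in> {1..<k}" for i k
      proof
        have I: "i \<in> ?I" "k \<in> ?I" "i \<noteq> k" "i \<noteq> 2 * n + 2 - k" using k i by auto
        define k' where "k' = 2 * n + 2 - k"
        have k': "k' \<in> ?I" "i \<noteq> k'" using I mirror unfolding k'_def by blast+
        have sym: "4 * h dvd f k + f k' + 2 * h" unfolding k'_def by (rule symD(2)[OF f I(2)])
        assume "R (f i) (f k)"
        then consider "2 * h dvd f i - f k" | "2 * h dvd f i + f k" unfolding R_def by blast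
        then show False
        proof cases
          case 1
          then have "4 * h dvd f i - f k - 2 * h" using reg(3)[OF I(1,2,3)] by (rule odd_multiple)
          from dvd_add[OF this sym] show False using reg(2)[OF I(1) k'(1)] by simp
        next
          case 2
          then have "4 * h dvd f i + f k - 2 * h" using reg(2)[OF I(1,2)] by (rule odd_multiple)
          then have "4 * h dvd (f i + f k - 2 * h) + 4 * h" by (rule dvd_add) simp
          from dvd_diff[OF this sym] show False using reg(3)[OF I(1) k'(1) k'(2)] by simp
        qed
      qed
      then show "g \<in> ?G" using X unfolding g by (auto simp: PiE_iff)
    qed
    show "ext ` ?G \<subseteq> ?F"
    proof
      fix f assume "f \<in> ext ` ?G"
      then obtain g where g: "g \<in> {1..n} \<rightarrow>\<^sub>E ?X"
          and gR: "\<And>i k. k \<in> {1..n} \<Longrightarrow> i \<in> {1..<k} \<Longrightarrow> \<not> R (g i) (g k)" and f: "f = ext g"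
        by blast
      have gX: "0 \<le> g i" "g i < 4 * h" "g i mod 2 = h mod 2" "\<not> h dvd g i" if "i \<in> {1..n}" for i
        using PiE_mem[OF g that] unfolding quarter_free_iff by blast+
      have f_low: "f i = g i" if "i \<in> {1..n}" for i using that by (simp add: f ext_def)
      have f_mid: "f (n + 1) = h" by (simp add: f ext_def)
      have f_high: "f i = (2 * h - g (2 * n + 2 - i)) mod (4 * h)" "2 * n + 2 - i \<in> {1..n}"
        if "i \<in> ?I" "n + 1 < i" for i using that by (auto simp: f ext_def)
      have cases_I: "i \<in> {1..n} \<or> i = n + 1 \<or> (i \<in> ?I \<and> n + 1 < i)" if "i \<in> ?I" for i
        using that by auto
      have high_mod: "4 * h dvd f i + g (2 * n + 2 - i) - 2 * h" if "i \<in> ?I" "n + 1 < i" for i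
      proof -
        have "f i mod (4 * h) = (2 * h - g (2 * n + 2 - i)) mod (4 * h)"
          unfolding f_high(1)[OF that] by simp
        then have "4 * h dvd f i - (2 * h - g (2 * n + 2 - i))" by (simp only: mod_eq_dvd_iff)
        then show ?thesis by (simp add: algebra_simps)
      qed
      have range: "0 \<le> f i \<and> f i < 4 * h" if "i \<in> ?I" for i
        using cases_I[OF that] gX(1,2)[of i] f_low[of i] f_mid f_high(1)[of i] h by auto
      have sym: "4 * h dvd f i + f (2 * n + 2 - i) + 2 * h" if i: "i \<in> ?I" for i
        using cases_I[OF i]
      proof (elim disjE conjE)
        assume i: "i \<in> {1..n}"
        then have i': "2 * n + 2 - i \<in> ?I" "n + 1 < 2 * n + 2 - i" "2 * n + 2 - (2 * n + 2 - i) = i" by auto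
        have "4 * h dvd (f (2 * n + 2 - i) + g i - 2 * h) + 4 * h"
          using high_mod[OF i'(1,2)] unfolding i'(3) by (rule dvd_add) simp
        then show ?thesis unfolding f_low[OF i] by (simp add: algebra_simps)
      next
        assume "i = n + 1"
        moreover have "2 * n + 2 - (n + 1) = n + 1" by simp
        ultimately show ?thesis using f_mid by simp
      next
        assume i: "i \<in> ?I" "n + 1 < i"
        have "4 * h dvd (f i + g (2 * n + 2 - i) - 2 * h) + 4 * h"
          using high_mod[OF i] by (rule dvd_add) simp
        then show ?thesis unfolding f_low[OF f_high(2)[OF i]] by (simp add: algebra_simps)
      qed
      have parity: "f i mod 2 = h mod 2" if i: "i \<in> ?I" for i
        using cases_I[OF i]
      proof (elim disjE conjE)
        assume i: "i \<in> ?I" "n + 1 < i"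
        have "2 * (2 * h) dvd f i + g (2 * n + 2 - i) - 2 * h" using high_mod[OF i] by simp
        then have "2 dvd f i + g (2 * n + 2 - i) - 2 * h" by (rule dvd_mult_left)
        then show ?thesis using gX(3)[OF f_high(2)[OF i]] by presburger
      qed (use gX(3) f_low f_mid in auto)
      \<comment> \<open>The lower of the two mirrored indices; the values at both agree up to sign modulo \<open>2 h\<close>.\<close>
      define \<kappa> where "\<kappa> i = (if i \<le> n + 1 then i else 2 * n + 2 - i)" for i
      have \<kappa>: "\<kappa> i \<in> {1..n} \<or> \<kappa> i = n + 1" if "i \<in> ?I" for i using that by (auto simp: \<kappa>_def)
      have \<kappa>R: "R (f i) (f (\<kappa> i))" if i: "i \<in> ?I" for i
      proof (cases "i \<le> n + 1")
        case False
        then have "2 * (2 * h) dvd f i + g (2 * n + 2 - i) - 2 * h" using high_mod[OF i] by simp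
        then have "2 * h dvd f i + g (2 * n + 2 - i) - 2 * h" by (rule dvd_mult_right)
        then have "2 * h dvd (f i + g (2 * n + 2 - i) - 2 * h) + 2 * h" by (rule dvd_add) simp
        moreover have "n + 1 < i" "\<kappa> i = 2 * n + 2 - i" using False by (simp_all add: \<kappa>_def)
        moreover have "f (2 * n + 2 - i) = g (2 * n + 2 - i)"
          by (rule f_low[OF f_high(2)[OF i \<open>n + 1 < i\<close>]])
        ultimately show ?thesis unfolding R_def by simp
      qed (simp add: R_def \<kappa>_def)
      have h_dvd: "\<kappa> i = n + 1" if i: "i \<in> ?I" and "h dvd f i" for i
      proof (rule ccontr)
        assume "\<kappa> i \<noteq> n + 1"
        then have low: "\<kappa> i \<in> {1..n}" using \<kappa>[OF i] by blast
        have "h dvd f i - f (\<kappa> i) \<or> h dvd f i + f (\<kappa> i)"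
          using \<kappa>R[OF i] dvd_mult_right[of 2 h] unfolding R_def by blast
        then have "h dvd f (\<kappa> i)" 
          using \<open>h dvd f i\<close> by (simp add: dvd_diff_right_iff dvd_add_right_iff)
        then show False using gX(4)[OF low] f_low[OF low] by simp
      qed
      have R_sym: "R v u" if "R u v" for u v using that unfolding R_def by (simp add: dvd_diff_commute add.commute)
      have R_trans: "R u w" if "R u v" "R v w" for u v w
        using dvd_add_or_diff_trans[of "2 * h" u v w] that(1) R_sym[OF that(2)] unfolding R_def by blast
      have h_mid: "h dvd v" if "R v h" for v
      proof -
        have "h dvd v - h \<or> h dvd v + h" using that dvd_mult_right[of 2 h] unfolding R_def by blast
        then show ?thesis using dvd_add[of h "v - h" h] by auto
      qed
      have \<kappa>_eq: "\<kappa> i = \<kappa> k" if ik: "i \<in> ?I" "k \<in> ?I" and "R (f i) (f k)" for i k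
      proof (rule ccontr)
        assume ne: "\<kappa> i \<noteq> \<kappa> k"
        have r: "R (f (\<kappa> i)) (f (\<kappa> k))"
          using R_trans[OF R_trans[OF R_sym[OF \<kappa>R[OF ik(1)]] \<open>R (f i) (f k)\<close>] \<kappa>R[OF ik(2)]] .
        consider "\<kappa> i \<in> {1..n}" "\<kappa> k \<in> {1..n}" | "\<kappa> i = n + 1" "\<kappa> k \<in> {1..n}"
          | "\<kappa> i \<in> {1..n}" "\<kappa> k = n + 1" using \<kappa>[OF ik(1)] \<kappa>[OF ik(2)] ne by auto
        then show False
        proof cases
          case 1
          have "\<not> R (g (\<kappa> i)) (g (\<kappa> k))"
          proof (cases "\<kappa> i < \<kappa> k")
            case True
            then show ?thesis using gR[OF 1(2), of "\<kappa> i"] 1 by auto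
          next
            case False
            then have "\<not> R (g (\<kappa> k)) (g (\<kappa> i))" using gR[OF 1(1), of "\<kappa> k"] 1 ne by auto
            then show ?thesis using R_sym by blast
          qed
          then show False using r unfolding f_low[OF 1(1)] f_low[OF 1(2)] by blast
        next
          case 2
          have "h dvd f (\<kappa> k)" using h_mid[OF R_sym[OF r[unfolded 2(1) f_mid]]] .
          then show False using gX(4)[OF 2(2)] f_low[OF 2(2)] by simp
        next
          case 3
          have "h dvd f (\<kappa> i)" using h_mid[OF r[unfolded 3(2) f_mid]] .
          then show False using gX(4)[OF 3(1)] f_low[OF 3(1)] by simp
        qed
      qed
      have \<kappa>_eq_cases: "k = i \<or> k = 2 * n + 2 - i" if "i \<in> ?I" "k \<in> ?I" "\<kappa> i = \<kappa> k" for i k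
        using that by (auto simp: \<kappa>_def split: if_splits)
      have not4: "\<not> 4 * h dvd 2 * h" using h zdvd_not_zless[of "2 * h" "4 * h"] by simp
      have R4: "R u v" if "4 * h dvd u - v \<or> 4 * h dvd u + v" for u v
      proof -
        have "2 * (2 * h) dvd u - v \<or> 2 * (2 * h) dvd u + v" using that by simp
        then show ?thesis using dvd_mult_right[of 2 "2 * h"] unfolding R_def by blast
      qed
      have "regular (2 * n + 1) (2 * h) f"
      proof (rule regularI)
        fix i k assume ik: "i \<in> ?I" "k \<in> ?I"
        show "even (f i - f k)" using parity[OF ik(1)] parity[OF ik(2)] by presburger
        show "\<not> 2 * (2 * h) dvd f i + f k" unfolding four
        proof
          assume d: "4 * h dvd f i + f k"
          then have "\<kappa> i = \<kappa> k" using R4 by (intro \<kappa>_eq[OF ik]) blast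
          then consider "k = i" | "k = 2 * n + 2 - i" using \<kappa>_eq_cases[OF ik] by blast
          then show False
          proof cases
            case 1
            then have "2 * (2 * h) dvd 2 * f i" using d by simp
            then have d2: "2 * h dvd f i" by (simp only: dvd_mult_cancel_left) simp
            then have "h dvd f i" by (rule dvd_mult_right)
            then have "\<kappa> i = n + 1" by (rule h_dvd[OF ik(1)])
            then have "R (f i) h" using \<kappa>R[OF ik(1)] f_mid by simp
            then have "2 * h dvd h" using d2 unfolding R_def
              by (auto simp: dvd_diff_right_iff dvd_add_right_iff)
            then show False using h zdvd_not_zless[of h "2 * h"] by simp
          next
            case 2
            have "4 * h dvd (f i + f k + 2 * h) - (f i + f k)"
              using sym[OF ik(1)] d unfolding 2 by (rule dvd_diff)
            then show False using not4 by simp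
          qed
        qed
        show "\<not> 2 * (2 * h) dvd f i - f k" if "i \<noteq> k" unfolding four
        proof
          assume d: "4 * h dvd f i - f k"
          then have "\<kappa> i = \<kappa> k" using R4 by (intro \<kappa>_eq[OF ik]) blast
          then have k: "k = 2 * n + 2 - i" using \<kappa>_eq_cases[OF ik] \<open>i \<noteq> k\<close> by blast
          have "4 * h dvd (f i + f k + 2 * h) + (f i - f k)"
            using sym[OF ik(1)] d unfolding k by (rule dvd_add)
          then have "2 * (2 * h) dvd 2 * (f i + h)" by (simp add: algebra_simps)
          then have "2 * h dvd f i + h" by (simp only: dvd_mult_cancel_left) simp
          then have "h dvd f i" by (intro h_mid) (simp add: R_def)
          then have "\<kappa> i = n + 1" by (rule h_dvd[OF ik(1)])
          then have "i = n + 1" using ik(1) by (auto simp: \<kappa>_def split: if_splits)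
          then show False using k \<open>i \<noteq> k\<close> by simp
        qed
      qed
      moreover have "f \<in> ?I \<rightarrow>\<^sub>E {0..<2 * (2 * h)}"
      proof (rule PiE_I)
        fix i assume "i \<in> ?I"
        then show "f i \<in> {0..<2 * (2 * h)}" using range by simp
      next
        fix i assume "i \<notin> ?I"
        then show "f i = undefined" by (simp only: f ext_def restrict_apply if_False)
      qed
      moreover have "f (n + 1) < 2 * h" using f_mid h by simp
      ultimately show "f \<in> ?F" unfolding symmetric_forms_def normal_forms_def four using sym by blast
    qed
  qed
qed

lemma card_symmetric_forms:
  assumes h: "h > 0" and n: "n > 0"
  shows "int (card (symmetric_forms n (2 * h))) =
    (\<Prod>i=1..n. int (card (quarter_free_residues h)) + 4 - 4 * int i)"
proof -
  obtain m where m: "n = Suc m" using n by (cases n) auto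
  let ?X = "quarter_free_residues h"
  let ?R = "\<lambda>u v. 2 * h dvd u - v \<or> 2 * h dvd u + v"
  let ?G = "{g \<in> {1..n} \<rightarrow>\<^sub>E ?X. g 1 \<in> ?X \<and> (\<forall>k\<in>{1..n}. \<forall>i\<in>{1..<k}. \<not> ?R (g i) (g k))}"
  have "1 \<in> {1..n}" using n by simp
  then have "?G = {g \<in> {1..n} \<rightarrow>\<^sub>E ?X. \<forall>k\<in>{1..n}. \<forall>i\<in>{1..<k}. \<not> ?R (g i) (g k)}"
    using PiE_mem by blast
  then have "card (symmetric_forms n (2 * h)) = card ?G"
    using bij_betw_same_card[OF bij_betw_symmetric_forms[OF h, of n]] by simp
  moreover have "int (card ?G) = int (card ?X) * (\<Prod>i=1..m. int (card ?X) - int 4 * int i)"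
    unfolding m
  proof (rule card_inequivalent_sequences)
    show "finite ?X" unfolding quarter_free_residues_def using finite_parity_residues by simp
    show "\<And>x y z. ?R x z \<Longrightarrow> ?R y z \<Longrightarrow> ?R x y" by (rule dvd_add_or_diff_trans)
    show "\<And>x. x \<in> ?X \<Longrightarrow> card {y \<in> ?X. ?R x y} = 4" by (rule card_class_quarter_free[OF _ h])
  qed blast
  moreover have "(\<Prod>i=1..m. int (card ?X) - int 4 * int i) = (\<Prod>i=Suc 1..Suc m. int (card ?X) + 4 - 4 * int i)"
    unfolding prod.shift_bounds_cl_Suc_ivl by (rule prod.cong) simp_all
  moreover have "int (card ?X) * (\<Prod>i=Suc 1..Suc m. int (card ?X) + 4 - 4 * int i)
      = (\<Prod>i=1..Suc m. int (card ?X) + 4 - 4 * int i)"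
    using prod.atLeast_Suc_atMost[of 1 "Suc m" "\<lambda>i. int (card ?X) + 4 - 4 * int i"] by simp
  ultimately show ?thesis unfolding m by simp
qed

section \<open>Points of the toric complement as normal forms\<close>

context orthonormal_frame
begin

text \<open>
  Doubled coordinates are integers for all points of the coweight lattice.
\<close>

definition half_vector :: "(nat \<Rightarrow> int) \<Rightarrow> 'a" where
  "half_vector u = (\<Sum>i=1..l. (of_int (u i) / 2) *\<^sub>R e i)"

lemma half_vector_inner: "k \<in> {1..l} \<Longrightarrow> half_vector u \<bullet> e k = of_int (u k) / 2"
  unfolding half_vector_def by (rule inner_sum_e)

lemma half_vector_eqI: "(\<And>i. i \<in> {1..l} \<Longrightarrow> x \<bullet> e i = of_int (u i) / 2) \<Longrightarrow> x = half_vector u"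
  by (rule frame_eqI) (simp add: half_vector_inner)

lemma half_vector_coweight_iff:
  "half_vector u \<in> Z \<longleftrightarrow> (\<forall>i\<in>{1..l}. \<forall>k\<in>{1..l}. even (u i - u k))"
proof
  assume "half_vector u \<in> Z"
  then obtain v where v: "\<And>i. i \<in> {1..l} \<Longrightarrow> half_vector u \<bullet> e i = of_int (v i) / 2"
    "\<And>i k. i \<in> {1..l} \<Longrightarrow> k \<in> {1..l} \<Longrightarrow> even (v i - v k)"
    using coweightE by blast
  have "u i = v i" if "i \<in> {1..l}" for i
    using v(1)[OF that] half_vector_inner[OF that, of u] by simp
  then show "\<forall>i\<in>{1..l}. \<forall>k\<in>{1..l}. even (u i - u k)" using v(2) by metis
next
  assume "\<forall>i\<in>{1..l}. \<forall>k\<in>{1..l}. even (u i - u k)"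
  then show "half_vector u \<in> Z" by (intro coweightI[where u = u] half_vector_inner) blast+
qed

lemma half_multiple_iff:
  "(\<exists>k::int. of_int n / 2 = real q * of_int k) \<longleftrightarrow> 2 * int q dvd n"
proof -
  have "of_int n / 2 = real q * of_int k \<longleftrightarrow> n = 2 * int q * k" for k
  proof -
    have "of_int n / 2 = real q * of_int k \<longleftrightarrow> real_of_int n = real_of_int (2 * int q * k)" by auto
    then show ?thesis by (simp only: of_int_eq_iff)
  qed
  then show ?thesis by (simp add: dvd_def)
qed

text \<open>
  Each root, written as a sum of two signed basis vectors, contributes one of the conditions of
  \<open>regular\<close>.
\<close>

lemma toric_iff_regular:
  "(half_vector u \<in> Z \<and> (\<forall>\<beta>\<in>Phi. \<not> (\<exists>k::int. \<beta> \<bullet> half_vector u = real q * of_int k)))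
    \<longleftrightarrow> regular l (int q) u" (is "?L \<longleftrightarrow> _")
proof
  have e_inner_u: "e i \<bullet> half_vector u = of_int (u i) / 2" if "i \<in> {1..l}" for i
    using half_vector_inner[OF that, of u] by (simp only: inner_commute)
  {
    assume L: ?L
    have not_dvd: "\<not> 2 * int q dvd n"
      if "a \<in> signed_basis" "b \<in> signed_basis" "a + b \<noteq> 0" "(a + b) \<bullet> half_vector u = of_int n / 2" for a b n
      using L rootI[OF that(1-3)] that(4) half_multiple_iff[of n q] by auto
    show "regular l (int q) u"
    proof (rule regularI)
      fix i k assume ik: "i \<in> {1..l}" "k \<in> {1..l}"
      show "even (u i - u k)" using L ik unfolding half_vector_coweight_iff by blast
      show "\<not> 2 * int q dvd u i + u k"
      proof (rule not_dvd[of "e i" "e k"])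
        show "e i + e k \<noteq> 0"
          by (rule signed_basis_add_nonzero) (use ik e_signed_basis in \<open>auto simp: e_inner\<close>)
        show "(e i + e k) \<bullet> half_vector u = of_int (u i + u k) / 2"
          by (simp add: inner_add_left e_inner_u[OF ik(1)] e_inner_u[OF ik(2)])
      qed (use ik e_signed_basis in auto)
      show "\<not> 2 * int q dvd u i - u k" if "i \<noteq> k"
      proof (rule not_dvd[of "e i" "- e k"])
        show "e i + - e k \<noteq> 0" using that e_inj[OF ik] by simp
        show "(e i + - e k) \<bullet> half_vector u = of_int (u i - u k) / 2"
          by (simp only: inner_add_left inner_minus_left e_inner_u[OF ik(1)] e_inner_u[OF ik(2)]) simp
      qed (use ik e_signed_basis uminus_signed_basis in auto)
    qed
  next
    assume reg: "regular l (int q) u"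
    note D = regularD[OF reg]
    have "\<not> (\<exists>k::int. \<beta> \<bullet> half_vector u = real q * of_int k)" if "\<beta> \<in> Phi" for \<beta>
    proof -
      obtain a b where ab: "a \<in> signed_basis" "b \<in> signed_basis" "a + b \<noteq> 0" "\<beta> = a + b"
        using \<open>\<beta> \<in> Phi\<close> unfolding roots_eq by blast
      have signed: "\<exists>i\<in>{1..l}. (d = e i \<and> d \<bullet> half_vector u = of_int (u i) / 2) \<or>
          (d = - e i \<and> d \<bullet> half_vector u = of_int (- u i) / 2)" if "d \<in> signed_basis" for d
        using that
      proof (cases rule: signed_basisE)
        case (1 i)
        then show ?thesis using e_inner_u[of i] by (intro bexI[of _ i]) simp_all
      next
        case (2 i)
        then show ?thesis using e_inner_u[of i] by (intro bexI[of _ i]) simp_all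
      qed
      obtain i where i: "i \<in> {1..l}" "(a = e i \<and> a \<bullet> half_vector u = of_int (u i) / 2) \<or>
          (a = - e i \<and> a \<bullet> half_vector u = of_int (- u i) / 2)" using signed[OF ab(1)] by blast
      obtain k where k: "k \<in> {1..l}" "(b = e k \<and> b \<bullet> half_vector u = of_int (u k) / 2) \<or>
          (b = - e k \<and> b \<bullet> half_vector u = of_int (- u k) / 2)" using signed[OF ab(2)] by blast
      have sum: "\<beta> \<bullet> half_vector u = a \<bullet> half_vector u + b \<bullet> half_vector u"
        unfolding ab(4) by (rule inner_add_left)
      have "\<exists>n. \<beta> \<bullet> half_vector u = of_int n / 2 \<and> \<not> 2 * int q dvd n"
        using i(2) k(2)
      proof (elim disjE conjE)
        assume h: "a = e i" "a \<bullet> half_vector u = of_int (u i) / 2" "b = e k" "b \<bullet> half_vector u = of_int (u k) / 2"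
        then show ?thesis using D(2)[OF i(1) k(1)] unfolding sum
          by (intro exI[of _ "u i + u k"]) simp
      next
        assume h: "a = e i" "a \<bullet> half_vector u = of_int (u i) / 2" "b = - e k" "b \<bullet> half_vector u = of_int (- u k) / 2"
        then have "i \<noteq> k" using ab(3) by auto
        then show ?thesis using h D(3)[OF i(1) k(1)] unfolding sum
          by (intro exI[of _ "u i - u k"]) simp
      next
        assume h: "a = - e i" "a \<bullet> half_vector u = of_int (- u i) / 2" "b = e k" "b \<bullet> half_vector u = of_int (u k) / 2"
        then have "k \<noteq> i" using ab(3) by auto
        then show ?thesis using h D(3)[OF k(1) i(1)] unfolding sum
          by (intro exI[of _ "u k - u i"]) simp
      next
        assume h: "a = - e i" "a \<bullet> half_vector u = of_int (- u i) / 2" "b = - e k" "b \<bullet> half_vector u = of_int (- u k) / 2"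
        have "\<not> 2 * int q dvd - (u i + u k)" using D(2)[OF i(1) k(1)] by (simp only: dvd_minus_iff) simp
        then show ?thesis using h unfolding sum
          by (intro exI[of _ "- (u i + u k)"]) simp
      qed
      then obtain n where n: "\<beta> \<bullet> half_vector u = of_int n / 2" "\<not> 2 * int q dvd n" by blast
      show ?thesis unfolding n(1) half_multiple_iff by (rule n(2))
    qed
    moreover have "half_vector u \<in> Z" using D(1) unfolding half_vector_coweight_iff by blast
    ultimately show ?L by blast
  }
qed

text \<open>
  The two alternatives correspond to the two kinds of lattice vectors, with even and with odd doubled
  coordinates.
\<close>

lemma coset_half_vector_iff:
  assumes q: "q > 0"
  shows "lattice_coset Phi q (half_vector u) = lattice_coset Phi q (half_vector v) \<longleftrightarrow>
    (\<forall>i\<in>{1..l}. 2 * int q dvd u i - v i) \<or> (\<forall>i\<in>{1..l}. 2 * int q dvd u i - v i - int q)"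
    (is "?L \<longleftrightarrow> ?A \<or> ?B")
proof
  assume ?L
  then obtain z where z: "z \<in> Z" "half_vector u = half_vector v + real q *\<^sub>R z"
    unfolding coset_eq_iff by blast
  obtain t where t: "\<And>i. i \<in> {1..l} \<Longrightarrow> z \<bullet> e i = of_int (t i) / 2"
    and parity: "\<And>i k. i \<in> {1..l} \<Longrightarrow> k \<in> {1..l} \<Longrightarrow> even (t i - t k)"
    using coweightE[OF z(1)] by blast
  have diff: "u i - v i = int q * t i" if i: "i \<in> {1..l}" for i
  proof -
    have "of_int (u i) / 2 = of_int (v i) / 2 + real q * (of_int (t i) / 2)"
      using arg_cong[OF z(2), of "\<lambda>x. x \<bullet> e i"]
      by (simp only: inner_add_left inner_scaleR_left half_vector_inner[OF i] t[OF i])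
    then have "real_of_int (u i) = real_of_int (v i + int q * t i)" by simp
    then have "u i = v i + int q * t i" by (simp only: of_int_eq_iff)
    then show ?thesis by simp
  qed
  have one: "1 \<in> {1..l}" using l_pos by simp
  show "?A \<or> ?B"
  proof (cases "even (t 1)")
    case True
    have "2 * int q dvd u i - v i" if i: "i \<in> {1..l}" for i
    proof -
      have "even (t i)" using parity[OF i one] True by simp
      then obtain m where "t i = 2 * m" by (rule evenE)
      then show ?thesis unfolding diff[OF i] by simp
    qed
    then show ?thesis by blast
  next
    case False
    have "2 * int q dvd u i - v i - int q" if i: "i \<in> {1..l}" for i
    proof -
      have "odd (t i)" using parity[OF i one] False by simp
      then obtain m where "t i = 2 * m + 1" by (rule oddE)
      then have "u i - v i - int q = 2 * int q * m" using diff[OF i] by (simp add: algebra_simps)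
      then show ?thesis by simp
    qed
    then show ?thesis by blast
  qed
next
  have eq: ?L if t: "\<And>i. i \<in> {1..l} \<Longrightarrow> u i = v i + int q * t i"
      and parity: "\<And>i k. even (t i - t k)" for t :: "nat \<Rightarrow> int"
  proof -
    have "half_vector t \<in> Z" unfolding half_vector_coweight_iff using parity by blast
    moreover have "half_vector u = half_vector v + real q *\<^sub>R half_vector t"
    proof (rule half_vector_eqI[symmetric])
      fix i assume i: "i \<in> {1..l}"
      show "(half_vector v + real q *\<^sub>R half_vector t) \<bullet> e i = of_int (u i) / 2"
        unfolding t[OF i] inner_add_left inner_scaleR_left half_vector_inner[OF i]
        by (simp add: add_divide_distrib)
    qed
    ultimately show ?thesis unfolding coset_eq_iff by blast
  qed
  assume "?A \<or> ?B"
  then show ?L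
  proof
    assume A: ?A
    show ?thesis
    proof (rule eq[of "\<lambda>i. 2 * ((u i - v i) div (2 * int q))"])
      fix i assume "i \<in> {1..l}"
      then have "2 * int q * ((u i - v i) div (2 * int q)) = u i - v i"
        using A by (intro dvd_mult_div_cancel) blast
      then show "u i = v i + int q * (2 * ((u i - v i) div (2 * int q)))" by (simp add: algebra_simps)
    qed simp
  next
    assume B: ?B
    show ?thesis
    proof (rule eq[of "\<lambda>i. 2 * ((u i - v i - int q) div (2 * int q)) + 1"])
      fix i assume "i \<in> {1..l}"
      then have "2 * int q * ((u i - v i - int q) div (2 * int q)) = u i - v i - int q"
        using B by (intro dvd_mult_div_cancel) blast
      then show "u i = v i + int q * (2 * ((u i - v i - int q) div (2 * int q)) + 1)"
        by (simp add: algebra_simps)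
    qed simp
  qed
qed

lemma regular_cong_shift:
  assumes reg: "regular l q u" and c: "c = 0 \<or> c = q"
    and g: "\<And>i. i \<in> {1..l} \<Longrightarrow> 2 * q dvd g i - (u i + c)"
  shows "regular l q g"
proof (rule regularI)
  fix i k assume ik: "i \<in> {1..l}" "k \<in> {1..l}"
  note D = regularD[OF reg ik] and gi = g[OF ik(1)] and gk = g[OF ik(2)]
  have diff: "2 * q dvd (g i - g k) - (u i - u k)"
    using dvd_diff[OF gi gk] by (simp add: algebra_simps)
  have "2 * q dvd (g i - (u i + c)) + (g k - (u k + c)) + 2 * c"
    using gi gk c by (intro dvd_add) auto
  then have sum: "2 * q dvd (g i + g k) - (u i + u k)" by (simp add: algebra_simps)
  have "even ((g i - g k) - (u i - u k))" using diff by (rule dvd_mult_left)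
  then show "even (g i - g k)" using D(1) by simp
  show "\<not> 2 * q dvd g i + g k" using dvd_diff[OF _ sum, of "g i + g k"] D(2) by auto
  show "\<not> 2 * q dvd g i - g k" if "i \<noteq> k" using dvd_diff[OF _ diff, of "g i - g k"] D(3)[OF that] by auto
qed

text \<open>
  Adding \<open>q\<close> to all coordinates modulo \<open>2 q\<close> moves the coordinate \<open>p\<close> from \<open>[0, q)\<close> to \<open>[q, 2 q)\<close> and
  back, so every coset has exactly one normal form.
\<close>

lemma bij_betw_normal_forms:
  assumes q: "q > 0" and p: "p \<in> {1..l}"
  shows "bij_betw (\<lambda>f. lattice_coset Phi q (half_vector f)) (normal_forms l (int q) p) (toric_complement Phi q)"
proof (rule bij_betw_imageI)
  let ?c = "\<lambda>f. lattice_coset Phi q (half_vector f)"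
  show "inj_on ?c (normal_forms l (int q) p)"
  proof (rule inj_onI)
    fix f g assume f: "f \<in> normal_forms l (int q) p" and g: "g \<in> normal_forms l (int q) p" and "?c f = ?c g"
    then consider "\<forall>i\<in>{1..l}. 2 * int q dvd f i - g i" | "\<forall>i\<in>{1..l}. 2 * int q dvd f i - g i - int q"
      unfolding coset_half_vector_iff[OF q] by blast
    then show "f = g"
    proof cases
      case 1
      have "f i = g i" if i: "i \<in> {1..l}" for i
      proof -
        have "\<bar>f i - g i\<bar> < 2 * int q"
          using normal_formsD(4,5)[OF f i] normal_formsD(4,5)[OF g i] by linarith
        moreover have "2 * int q dvd f i - g i" using 1 i by blast
        ultimately have "f i - g i = 0" by (rule dvd_imp_eq_of_small[rotated])
        then show ?thesis by simp
      qed
      then show ?thesis by (rule PiE_ext[OF normal_formsD(1)[OF f] normal_formsD(1)[OF g]])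
    next
      case 2
      have "\<bar>f p - g p - int q\<bar> < 2 * int q"
        using normal_formsD(3)[OF f] normal_formsD(3)[OF g] normal_formsD(4)[OF f p] normal_formsD(4)[OF g p] by linarith
      moreover have "2 * int q dvd f p - g p - int q" using 2 p by blast
      ultimately have "f p - g p - int q = 0" by (rule dvd_imp_eq_of_small[rotated])
      then have False
        using normal_formsD(3)[OF f] normal_formsD(4)[OF g p] by linarith
      then show ?thesis ..
    qed
  qed
  show "?c ` normal_forms l (int q) p = toric_complement Phi q"
  proof (intro equalityI subsetI)
    fix t assume "t \<in> ?c ` normal_forms l (int q) p"
    then obtain f where f: "f \<in> normal_forms l (int q) p" "t = ?c f" by blast
    then show "t \<in> toric_complement Phi q"
      using normal_formsD(2)[OF f(1)] unfolding toric_iff_regular[symmetric] toric_complement_def by blast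
  next
    fix t assume "t \<in> toric_complement Phi q"
    then obtain x where x: "t = lattice_coset Phi q x" "x \<in> Z"
        "\<forall>\<beta>\<in>Phi. \<not> (\<exists>k::int. \<beta> \<bullet> x = real q * of_int k)"
      unfolding toric_complement_def by blast
    obtain u where u: "\<And>i. i \<in> {1..l} \<Longrightarrow> x \<bullet> e i = of_int (u i) / 2"
      and "\<And>i k. i \<in> {1..l} \<Longrightarrow> k \<in> {1..l} \<Longrightarrow> even (u i - u k)"
      using coweightE[OF x(2)] by blast
    have xu: "x = half_vector u" by (rule half_vector_eqI[OF u])
    have reg: "regular l (int q) u" using x(2,3) unfolding xu toric_iff_regular[symmetric] by blast
    define c where "c = (if u p mod (2 * int q) < int q then 0 else int q)"
    have c: "c = 0 \<or> c = int q" by (simp add: c_def)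
    define g where "g = (\<lambda>i\<in>{1..l}. (u i + c) mod (2 * int q))"
    have g: "g i = (u i + c) mod (2 * int q)" if "i \<in> {1..l}" for i using that by (simp add: g_def)
    have g_dvd: "2 * int q dvd g i - (u i + c)" if "i \<in> {1..l}" for i
      unfolding g[OF that] by (simp flip: mod_eq_dvd_iff)
    have "g \<in> {1..l} \<rightarrow>\<^sub>E {0..<2 * int q}"
      using q by (simp add: g_def)
    moreover have "regular l (int q) g" by (rule regular_cong_shift[OF reg c g_dvd])
    moreover have "g p < int q"
    proof (cases "u p mod (2 * int q) < int q")
      case True
      then show ?thesis unfolding g[OF p] by (simp add: c_def)
    next
      case False
      define r where "r = u p mod (2 * int q)"
      have r: "int q \<le> r" "r < 2 * int q" using False q by (simp_all add: r_def)
      have "(u p + int q) mod (2 * int q) = (r + int q) mod (2 * int q)" by (simp add: r_def mod_simps)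
      also have "\<dots> = (r - int q + 2 * int q) mod (2 * int q)" by (simp add: algebra_simps)
      also have "\<dots> = (r - int q) mod (2 * int q)" by (rule mod_add_self2)
      also have "\<dots> = r - int q" using r by simp
      finally show ?thesis using False r(2) unfolding g[OF p] by (simp add: c_def)
    qed
    ultimately have "g \<in> normal_forms l (int q) p" unfolding normal_forms_def by blast
    moreover have "?c g = t"
    proof -
      have "(\<forall>i\<in>{1..l}. 2 * int q dvd g i - u i) \<or> (\<forall>i\<in>{1..l}. 2 * int q dvd g i - u i - int q)"
        using c g_dvd by (auto simp: diff_diff_eq)
      then show ?thesis unfolding x(1) xu coset_half_vector_iff[OF q] .
    qed
    ultimately show "t \<in> ?c ` normal_forms l (int q) p" by blast
  qed
qed

lemma fixed_count_eq_card_normal_forms: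
  assumes q: "q > 0" and p: "p \<in> {1..l}"
  shows "fixed_count Phi q w = card {f \<in> normal_forms l (int q) p.
    w ` lattice_coset Phi q (half_vector f) = lattice_coset Phi q (half_vector f)}"
proof -
  let ?c = "\<lambda>f. lattice_coset Phi q (half_vector f)" and ?N = "normal_forms l (int q) p"
  have inj: "inj_on ?c ?N" and image: "?c ` ?N = toric_complement Phi q"
    using bij_betw_normal_forms[OF q p] unfolding bij_betw_def by blast+
  have image_Collect: "{t \<in> c ` N. P t} = c ` {f \<in> N. P (c f)}"
    for c :: "(nat \<Rightarrow> int) \<Rightarrow> 'a set" and N P by blast
  have "{t \<in> toric_complement Phi q. w ` t = t} = ?c ` {f \<in> ?N. w ` ?c f = ?c f}"
    unfolding image[symmetric] by (rule image_Collect)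
  moreover have "inj_on ?c {f \<in> ?N. w ` ?c f = ?c f}"
    by (rule inj_on_subset[OF inj]) (rule Collect_restrict)
  ultimately show ?thesis unfolding fixed_count_def by (simp only: card_image)
qed

lemma fixed_count_id:
  assumes "q > 0"
  shows "fixed_count Phi q id = card (normal_forms l (int q) 1)"
  using fixed_count_eq_card_normal_forms[OF assms, of 1 id] l_pos by simp

text \<open>
  A coset equals its image if mirrored coordinates add up to 0 or to \<open>q\<close> modulo \<open>2 q\<close>, the same
  alternative for all of them. A sum that is 0 would put the point on a root hyperplane.
\<close>

lemma fixed_count_minus_reversal:
  assumes q: "q > 0" and l: "l = 2 * n + 1"
  shows "fixed_count Phi q minus_reversal = card (symmetric_forms n (int q))"
proof -
  have "n + 1 \<in> {1..l}" using l by simp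
  note count = fixed_count_eq_card_normal_forms[OF q this, of minus_reversal]
  have "{f \<in> normal_forms l (int q) (n + 1). minus_reversal ` lattice_coset Phi q (half_vector f)
      = lattice_coset Phi q (half_vector f)} = symmetric_forms n (int q)"
  proof -
    have "minus_reversal ` lattice_coset Phi q (half_vector f) = lattice_coset Phi q (half_vector f)
        \<longleftrightarrow> (\<forall>i\<in>{1..l}. 2 * int q dvd f i + f (l + 1 - i) + int q)"
      if f: "f \<in> normal_forms l (int q) (n + 1)" for f
    proof -
      have eq: "minus_reversal (half_vector f) = half_vector (\<lambda>i. - f (l + 1 - i))"
      proof (rule half_vector_eqI)
        fix i assume i: "i \<in> {1..l}"
        show "minus_reversal (half_vector f) \<bullet> e i = of_int (- f (l + 1 - i)) / 2"
          unfolding minus_reversal_inner[OF i] half_vector_inner[OF opposite_index(1)[OF i]] by simp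
      qed
      have neg: "2 * int q dvd - f (l + 1 - i) - f i \<longleftrightarrow> 2 * int q dvd f i + f (l + 1 - i)" for i
      proof -
        have "- f (l + 1 - i) - f i = - (f i + f (l + 1 - i))" by simp
        then show ?thesis by (simp only: dvd_minus_iff)
      qed
      have neg': "2 * int q dvd - f (l + 1 - i) - f i - int q \<longleftrightarrow> 2 * int q dvd f i + f (l + 1 - i) + int q" for i
      proof -
        have "- f (l + 1 - i) - f i - int q = - (f i + f (l + 1 - i) + int q)" by simp
        then show ?thesis by (simp only: dvd_minus_iff)
      qed
      have "1 \<in> {1..l}" using l_pos by simp
      then have "\<not> (\<forall>i\<in>{1..l}. 2 * int q dvd f i + f (l + 1 - i))"
        using regularD(2)[OF normal_formsD(2)[OF f] \<open>1 \<in> {1..l}\<close> opposite_index(1)[OF \<open>1 \<in> {1..l}\<close>]] by blast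
      then show ?thesis
        unfolding hyperoctahedral_coset[OF minus_reversal_hyperoctahedral] eq coset_half_vector_iff[OF q] neg neg'
        by blast
    qed
    then have "{f \<in> normal_forms l (int q) (n + 1). minus_reversal ` lattice_coset Phi q (half_vector f)
        = lattice_coset Phi q (half_vector f)} =
      {f \<in> normal_forms l (int q) (n + 1). \<forall>i\<in>{1..l}. 2 * int q dvd f i + f (l + 1 - i) + int q}"
      by blast
    moreover have "l + 1 - i = 2 * n + 2 - i" for i using l by simp
    ultimately show ?thesis unfolding symmetric_forms_def by (simp add: l)
  qed
  then show ?thesis unfolding count by simp
qed

end

section \<open>The characters\<close>

theorem theorem5p4:
  fixes l q :: nat
    and e \<alpha> :: "nat \<Rightarrow> real ^ 'n"
    and \<Phi> :: "(real ^ 'n) set"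
    and \<omega> :: "real ^ 'n \<Rightarrow> real ^ 'n"
  assumes "bij_betw e {1..l} Basis"
    and "l \<ge> 3" and "odd l"
    and "\<Phi> = roots_C l e" and "\<alpha> = simple_root_C l e"
    and "\<omega> \<in> alcove_stabilizer \<Phi> \<alpha> l"
    and "q > 0"
  shows "alcove_stabilizer \<Phi> \<alpha> l = {id, omega \<Phi> \<alpha> l l} \<and>
    (\<omega> = id \<and> odd q \<longrightarrow>
       int (fixed_count \<Phi> q \<omega>) = (\<Prod>i=1..l. int q - (2 * int i - 1))) \<and>
    (\<omega> = id \<and> even q \<longrightarrow>
       int (fixed_count \<Phi> q \<omega>) = (\<Prod>i=1..l-1. int q - 2 * int i) * (int q - int l)) \<and>
    (\<omega> = omega \<Phi> \<alpha> l l \<and> gcd 4 q = 1 \<longrightarrow>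
       int (fixed_count \<Phi> q \<omega>) = 0) \<and>
    (\<omega> = omega \<Phi> \<alpha> l l \<and> gcd 4 q = 2 \<longrightarrow>
       int (fixed_count \<Phi> q \<omega>) = (\<Prod>i=1..(l-1) div 2. int q - (4 * int i - 2))) \<and>
    (\<omega> = omega \<Phi> \<alpha> l l \<and> gcd 4 q = 4 \<longrightarrow>
       int (fixed_count \<Phi> q \<omega>) = (\<Prod>i=1..(l-1) div 2. int q - 4 * int i))"
proof -
  interpret orthonormal_frame l e by unfold_locales fact
  obtain n where n: "l = 2 * n + 1" using \<open>odd l\<close> by (rule oddE)
  then have n': "(l - 1) div 2 = n" "n > 0" using \<open>l \<ge> 3\<close> by simp_all
  have stab: "alcove_stabilizer \<Phi> \<alpha> l = {id, omega \<Phi> \<alpha> l l}"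
    unfolding \<open>\<Phi> = _\<close> \<open>\<alpha> = _\<close> omega_eq by (rule alcove_stabilizer_eq)
  have count_id: "fixed_count \<Phi> q id = card (normal_forms l (int q) 1)"
    unfolding \<open>\<Phi> = _\<close> by (rule fixed_count_id[OF \<open>q > 0\<close>])
  have count_omega: "fixed_count \<Phi> q (omega \<Phi> \<alpha> l l) = card (symmetric_forms n (int q))"
    unfolding \<open>\<Phi> = _\<close> \<open>\<alpha> = _\<close> omega_eq by (rule fixed_count_minus_reversal[OF \<open>q > 0\<close> n])
  have q: "int q > 0" using \<open>q > 0\<close> by simp
  have id_odd: "int (fixed_count \<Phi> q id) = (\<Prod>i=1..l. int q - (2 * int i - 1))" if "odd q"
    unfolding count_id using card_normal_forms_odd[OF q _ l_pos] that by simp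
  have id_even: "int (fixed_count \<Phi> q id) = (\<Prod>i=1..l-1. int q - 2 * int i) * (int q - int l)" if "even q"
    unfolding count_id using card_normal_forms_even[OF q _ l_pos] that by simp
  have omega_1: "int (fixed_count \<Phi> q (omega \<Phi> \<alpha> l l)) = 0" if "gcd 4 q = 1"
  proof -
    have "odd q"
    proof
      assume "even q"
      then have "2 dvd gcd 4 q" by (intro gcd_greatest) simp_all
      then show False using that by simp
    qed
    then show ?thesis unfolding count_omega by (simp add: symmetric_forms_odd)
  qed
  have omega_2: "int (fixed_count \<Phi> q (omega \<Phi> \<alpha> l l)) = (\<Prod>i=1..(l-1) div 2. int q - (4 * int i - 2))"
    if "gcd 4 q = 2"
  proof -
    have "2 dvd q" using that gcd_dvd2[of 4 q] by simp
    then obtain h where h: "q = 2 * h" by (rule dvdE)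
    have "odd h"
    proof
      assume "even h"
      then have "4 dvd q" unfolding h by auto
      then have "4 dvd gcd 4 q" by (intro gcd_greatest) simp_all
      then show False using that by simp
    qed
    have "h > 0" using \<open>q > 0\<close> h by simp
    then show ?thesis
      unfolding count_omega n' using card_symmetric_forms[of "int h" n] card_quarter_free_residues[of "int h"] \<open>odd h\<close> n'(2)
      by (simp add: h algebra_simps)
  qed
  have omega_4: "int (fixed_count \<Phi> q (omega \<Phi> \<alpha> l l)) = (\<Prod>i=1..(l-1) div 2. int q - 4 * int i)"
    if "gcd 4 q = 4"
  proof -
    have "4 dvd q" using that gcd_dvd2[of 4 q] by simp
    then obtain k where k: "q = 4 * k" by (rule dvdE)
    define h where "h = 2 * k"
    have h: "q = 2 * h" "even h" "h > 0" using k \<open>q > 0\<close> by (simp_all add: h_def)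
    then show ?thesis
      unfolding count_omega n' using card_symmetric_forms[of "int h" n] card_quarter_free_residues[of "int h"] n'(2)
      by simp
  qed
  show ?thesis
    by (intro conjI impI; (elim conjE)?;
        (rule stab | (hypsubst, rule id_odd id_even omega_1 omega_2 omega_4, assumption)))
qed

end
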